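(* Let $m\ge 2$ be an integer, let $\delta>-m$ be real, and put $\tau=3+\delta/m$. Let $H$ be a connected directed graph on $k$ vertices and let $\pi$ be an ordering of its vertices such that $(H,\pi)$ is attainable. Define $$B(H,\pi)=\max_{s\in\{0,1,\dots,k\}}\Big(-s+\sum_{i=s+1}^{k}\beta(\pi^{-1}(i))\Big),\qquad \beta(x)=\frac{\tau-2}{\tau-1}\big(d^{\mathrm{(in)}}_H(x)-d^{\mathrm{(out)}}_H(x)\big)-d^{\mathrm{(in)}}_H(x),$$ and let $r$ be the number of different $s\in\{0,1,\dots,k\}$ attaining this maximum. Then there exist constants $0<C_1\le C_2<\infty$ (not depending on $t$) such that $$C_1\le \liminf_{t\to\infty}\frac{\mathbb{E}[N_t(H,\pi)]}{t^{k+B(H,\pi)}\log^{r-1}(t)}\le \limsup_{t\to\infty}\frac{\mathbb{E}[N_t(H,\pi)]}{t^{k+B(H,\pi)}\log^{r-1}(t)}\le C_2 .$$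
   Context: Preferential attachment model $\mathrm{PA}_t=\mathrm{PA}_t(m,\delta)$: a growing random directed multigraph. $\mathrm{PA}_1$ is a single vertex $1$ without edges; $\mathrm{PA}_2$ has vertices $1,2$ and $m$ edges from $2$ to $1$. For $t\ge 3$, given $\mathrm{PA}_{t-1}$, a vertex $t$ is added with $m$ edges, labeled $j=1,\dots,m$, directed from $t$ to vertices $E_{t,1},\dots,E_{t,m}\in\{1,\dots,t-1\}$ chosen sequentially: conditionally on $\mathrm{PA}_{t-1}$ and the first $j-1$ edges of $t$, $$\mathbb{P}(E_{t,j}=i\mid \cdot)=\frac{D_i(t-1,j-1)+\delta}{2m(t-2)+(j-1)+(t-1)\delta},\qquad i\in\{1,\dots,t-1\},$$ where $D_i(t-1,j-1)$ is the (total) degree of $i$ after the first $j-1$ edges of $t$ have been attached. Multiple edges are allowed. For $t=2$ put $E_{2,j}=1$ for all $j$. A labeled edge is a triple $(u,v,j)$ with $u<v$, $j\in\{1,\dots,m\}$, directed from $v$ to $u$; it belongs to $E(\mathrm{PA}_t)$ iff $v\le t$ and $E_{v,j}=u$. An ordering of a directed graph $H$ on $k$ vertices is a bijection $\pi:V_H\to\{1,\dots,k\}$, prescribing the order of arrival ($\pi(x)<\pi(y)$ means $x$ is older than $y$). $(H,\pi)$ is attainable if every edge of $H$ goes from a newer to an older vertex (an edge $x\to y$ has $\pi(x)>\pi(y)$; in particular $H$ is acyclic) and all out-degrees in $H$ are at most $m$. $d^{\mathrm{(in)}}_H(x)$, $d^{\mathrm{(out)}}_H(x)$ are the in- and out-degree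 of $x$ in $H$. $N_t(H,\pi)$ is the number of (labeled) copies of $(H,\pi)$ in $\mathrm{PA}_t$: pairs of a vertex set $\{i_1<\dots<i_k\}\subseteq\{1,\dots,t\}$ and a set $M\subseteq E(\mathrm{PA}_t)$ of labeled edges between these vertices such that, for all $a,b$, the number of elements of $M$ directed from $i_a$ to $i_b$ equals the number of edges of $H$ from $\pi^{-1}(a)$ to $\pi^{-1}(b)$. *)

theory Defs
  imports "HOL-Probability.Probability" "Graph_Theory.Graph_Theory"
begin

text \<open>
  A realisation of the preferential attachment process is its target function \<open>E\<close>:
  \<open>E v j\<close> is the endpoint of the \<open>j\<close>-th edge of vertex \<open>v\<close>, and \<open>0\<close> (which is not a vertex)
  if that edge has not been attached.
\<close>
type_synonym targets = "nat \<Rightarrow> nat \<Rightarrow> nat"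

text \<open>
  Out-edges (newer endpoint, label) present once the first \<open>j\<close> edges of vertex \<open>t + 1\<close> have
  been attached to a graph on \<open>{1..t}\<close>.
\<close>
definition attached :: "nat \<Rightarrow> nat \<Rightarrow> nat \<Rightarrow> (nat \<times> nat) set" where
  "attached m t j = {2..t} \<times> {1..m} \<union> {Suc t} \<times> {1..j}"

text \<open>\<open>PA_degree m E i t j\<close> is the degree \<open>D\<^sub>i(t, j)\<close>: in-degree plus out-degree.\<close>
definition PA_degree :: "nat \<Rightarrow> targets \<Rightarrow> nat \<Rightarrow> nat \<Rightarrow> nat \<Rightarrow> nat" where
  "PA_degree m E i t j = card {(v, l) \<in> attached m t j. E v l = i} + card {(v, l) \<in> attached m t j. v = i}"

definition attach_weight :: "nat \<Rightarrow> real \<Rightarrow> targets \<Rightarrow> nat \<Rightarrow> nat \<Rightarrow> nat \<Rightarrow> real" where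
  "attach_weight m \<delta> E t j i =
     (if i \<in> {1..t - 1}
      then (real (PA_degree m E i (t - 1) (j - 1)) + \<delta>)
           / (2 * real m * (real t - 2) + (real j - 1) + (real t - 1) * \<delta>)
      else 0)"

text \<open>
  Conditional law of \<open>E\<^sub>t\<^sub>,\<^sub>j\<close>. The weights form a probability distribution
  in all states the process can reach, see \<open>pmf_attach_PA\<close> below.
\<close>
definition attach_pmf :: "nat \<Rightarrow> real \<Rightarrow> targets \<Rightarrow> nat \<Rightarrow> nat \<Rightarrow> nat pmf" where
  "attach_pmf m \<delta> E t j = embed_pmf (attach_weight m \<delta> E t j)"

fun attach_edges :: "nat \<Rightarrow> real \<Rightarrow> nat \<Rightarrow> nat \<Rightarrow> targets \<Rightarrow> targets pmf" where
  "attach_edges m \<delta> t 0 E = return_pmf E"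
| "attach_edges m \<delta> t (Suc j) E =
     bind_pmf (attach_edges m \<delta> t j E) (\<lambda>F.
     map_pmf (\<lambda>i. F(t := (F t)(Suc j := i))) (attach_pmf m \<delta> F t (Suc j)))"

text \<open>The law of \<open>PA\<^sub>t(m, \<delta>)\<close>; the value at \<open>t = 0\<close> is a dummy.\<close>
fun PA :: "nat \<Rightarrow> real \<Rightarrow> nat \<Rightarrow> targets pmf" where
  "PA m \<delta> 0 = return_pmf (\<lambda>_ _. 0)"
| "PA m \<delta> (Suc 0) = return_pmf (\<lambda>_ _. 0)"
| "PA m \<delta> (Suc (Suc 0)) = return_pmf (\<lambda>v j. if v = 2 \<and> j \<in> {1..m} then 1 else 0)"
| "PA m \<delta> (Suc (Suc (Suc n))) =
     bind_pmf (PA m \<delta> (Suc (Suc n))) (attach_edges m \<delta> (Suc (Suc (Suc n))) m)"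

definition labeled_edges :: "nat \<Rightarrow> nat \<Rightarrow> targets \<Rightarrow> (nat \<times> nat \<times> nat) set" where
  "labeled_edges m t E = {(u, v, j). 1 \<le> u \<and> u < v \<and> v \<le> t \<and> j \<in> {1..m} \<and> E v j = u}"

definition arrival_order :: "('a, 'b) pre_digraph \<Rightarrow> ('a \<Rightarrow> nat) \<Rightarrow> bool" where
  "arrival_order H \<pi> \<longleftrightarrow> bij_betw \<pi> (verts H) {1..card (verts H)}"

definition vertex_at :: "('a, 'b) pre_digraph \<Rightarrow> ('a \<Rightarrow> nat) \<Rightarrow> nat \<Rightarrow> 'a" where
  "vertex_at H \<pi> i = inv_into (verts H) \<pi> i"

definition attainable :: "nat \<Rightarrow> ('a, 'b) pre_digraph \<Rightarrow> ('a \<Rightarrow> nat) \<Rightarrow> bool" where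
  "attainable m H \<pi> \<longleftrightarrow>
     (\<forall>e\<in>arcs H. \<pi> (tail H e) > \<pi> (head H e)) \<and> (\<forall>x\<in>verts H. out_degree H x \<le> m)"

text \<open>\<open>sorted_list_of_set S ! (a - 1)\<close> is the \<open>a\<close>-th smallest element \<open>i\<^sub>a\<close> of \<open>S\<close>.\<close>
definition copies ::
  "nat \<Rightarrow> nat \<Rightarrow> ('a, 'b) pre_digraph \<Rightarrow> ('a \<Rightarrow> nat) \<Rightarrow> targets \<Rightarrow> (nat set \<times> (nat \<times> nat \<times> nat) set) set"
  where
  "copies m t H \<pi> E = {(S, M).
     S \<subseteq> {1..t} \<and> card S = card (verts H) \<and>
     M \<subseteq> labeled_edges m t E \<and> (\<forall>(u, v, j)\<in>M. u \<in> S \<and> v \<in> S) \<and>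
     (\<forall>a\<in>{1..card (verts H)}. \<forall>b\<in>{1..card (verts H)}.
        card {(u, v, j) \<in> M. v = sorted_list_of_set S ! (a - 1) \<and> u = sorted_list_of_set S ! (b - 1)}
        = card {e \<in> arcs H. tail H e = vertex_at H \<pi> a \<and> head H e = vertex_at H \<pi> b})}"

definition num_copies :: "nat \<Rightarrow> nat \<Rightarrow> ('a, 'b) pre_digraph \<Rightarrow> ('a \<Rightarrow> nat) \<Rightarrow> targets \<Rightarrow> nat" where
  "num_copies m t H \<pi> E = card (copies m t H \<pi> E)"

definition expected_N :: "nat \<Rightarrow> real \<Rightarrow> nat \<Rightarrow> ('a, 'b) pre_digraph \<Rightarrow> ('a \<Rightarrow> nat) \<Rightarrow> real" where
  "expected_N m \<delta> t H \<pi> = measure_pmf.expectation (PA m \<delta> t) (\<lambda>E. real (num_copies m t H \<pi> E))"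

definition beta_weight :: "real \<Rightarrow> ('a, 'b) pre_digraph \<Rightarrow> 'a \<Rightarrow> real" where
  "beta_weight \<tau> H x = (\<tau> - 2) / (\<tau> - 1) * (real (in_degree H x) - real (out_degree H x)) - real (in_degree H x)"

definition B_objective :: "real \<Rightarrow> ('a, 'b) pre_digraph \<Rightarrow> ('a \<Rightarrow> nat) \<Rightarrow> nat \<Rightarrow> real" where
  "B_objective \<tau> H \<pi> s = - real s + (\<Sum>i = s + 1..card (verts H). beta_weight \<tau> H (vertex_at H \<pi> i))"

definition B_exponent :: "real \<Rightarrow> ('a, 'b) pre_digraph \<Rightarrow> ('a \<Rightarrow> nat) \<Rightarrow> real" where
  "B_exponent \<tau> H \<pi> = (MAX s\<in>{0..card (verts H)}. B_objective \<tau> H \<pi> s)"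

definition num_maximizers :: "real \<Rightarrow> ('a, 'b) pre_digraph \<Rightarrow> ('a \<Rightarrow> nat) \<Rightarrow> nat" where
  "num_maximizers \<tau> H \<pi> = card {s \<in> {0..card (verts H)}. B_objective \<tau> H \<pi> s = B_exponent \<tau> H \<pi>}"


subsection \<open>The attachment rule is a probability distribution in all reachable states\<close>

definition valid_state :: "nat \<Rightarrow> targets \<Rightarrow> nat \<Rightarrow> nat \<Rightarrow> bool" where
  "valid_state m E t j \<longleftrightarrow> (\<forall>(v, l) \<in> attached m t j. E v l \<in> {1..<v})"

lemma finite_attached [simp]: "finite (attached m t j)"
  by (simp add: attached_def)

lemma finite_attached_if [simp]: "finite {(v, l). (v, l) \<in> attached m t j \<and> P v l}"
  by (rule finite_subset[OF _ finite_attached]) auto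

lemma PA_degree_ge:
  assumes val: "valid_state m E t j" and i: "i \<in> {1..t}" and t: "2 \<le> t"
  shows "m \<le> PA_degree m E i t j"
proof (cases "i = 1")
  case True
  have "(\<lambda>l. (2, l)) ` {1..m} \<subseteq> {(v, l) \<in> attached m t j. E v l = i}"
  proof safe
    fix l assume l: "l \<in> {1..m}"
    then show a: "(2, l) \<in> attached m t j" using t by (auto simp: attached_def)
    then have "E 2 l \<in> {1..<2}" using val unfolding valid_state_def by blast
    then show "E 2 l = i" using True by auto
  qed
  from card_mono[OF _ this] have "m \<le> card {(v, l) \<in> attached m t j. E v l = i}"
    by (simp add: card_image inj_on_def)
  then show ?thesis by (simp add: PA_degree_def)
next
  case False
  have "(\<lambda>l. (i, l)) ` {1..m} \<subseteq> {(v, l) \<in> attached m t j. v = i}"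
    using False i by (auto simp: attached_def)
  from card_mono[OF _ this] have "m \<le> card {(v, l) \<in> attached m t j. v = i}"
    by (simp add: card_image inj_on_def)
  then show ?thesis by (simp add: PA_degree_def)
qed

lemma sum_PA_degree:
  assumes val: "valid_state m E t j" and t: "2 \<le> t"
  shows "(\<Sum>i = 1..t. PA_degree m E i t j) = 2 * m * (t - 1) + j"
proof -
  have c: "card (attached m t j) = m * (t - 1) + j"
    unfolding attached_def by (subst card_Un_disjoint) (auto simp: card_cartesian_product)
  have 1: "(\<Sum>i = 1..t. card {(v, l) \<in> attached m t j. E v l = i}) = card (attached m t j)"
  proof -
    have "(\<Sum>i = 1..t. card {(v, l) \<in> attached m t j. E v l = i})
        = card (\<Union>i\<in>{1..t}. {(v, l) \<in> attached m t j. E v l = i})"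
      by (rule card_UN_disjoint[symmetric]) auto
    also have "(\<Union>i\<in>{1..t}. {(v, l) \<in> attached m t j. E v l = i}) = attached m t j"
    proof -
      have "E v l \<in> {1..t}" if "(v, l) \<in> attached m t j" for v l
      proof -
        have "E v l \<in> {1..<v}" using val that unfolding valid_state_def by blast
        moreover have "v \<le> Suc t" using that by (auto simp: attached_def)
        ultimately show ?thesis by auto
      qed
      then show ?thesis by auto
    qed
    finally show ?thesis .
  qed
  have 2: "(\<Sum>i = 1..t. card {(v, l) \<in> attached m t j. v = i}) = m * (t - 1)"
  proof -
    have "(\<Sum>i = 1..t. card {(v, l) \<in> attached m t j. v = i})
        = card (\<Union>i\<in>{1..t}. {(v, l) \<in> attached m t j. v = i})"
      by (rule card_UN_disjoint[symmetric]) auto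
    also have "(\<Union>i\<in>{1..t}. {(v, l) \<in> attached m t j. v = i}) = {2..t} \<times> {1..m}"
      by (auto simp: attached_def)
    finally show ?thesis by (simp add: card_cartesian_product)
  qed
  show ?thesis unfolding PA_degree_def sum.distrib 1 2 c by (simp add: algebra_simps)
qed

lemma pmf_attach:
  assumes m: "1 \<le> m" and \<delta>: "\<delta> > - real m" and t: "3 \<le> t"
    and val: "valid_state m E (t - 1) j"
  shows "pmf (attach_pmf m \<delta> E t (Suc j)) i = attach_weight m \<delta> E t (Suc j) i"
proof -
  let ?w = "attach_weight m \<delta> E t (Suc j)"
  let ?Z = "2 * real m * (real t - 2) + real j + (real t - 1) * \<delta>"
  have deg: "real (PA_degree m E i (t - 1) j) + \<delta> > 0" if "i \<in> {1..t - 1}" for i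
    using PA_degree_ge[OF val that] t \<delta> by fastforce
  have sum: "(\<Sum>i = 1..t - 1. real (PA_degree m E i (t - 1) j) + \<delta>) = ?Z"
  proof -
    have "real (\<Sum>i = 1..t - 1. PA_degree m E i (t - 1) j) = 2 * real m * (real t - 2) + real j"
    proof -
      have "(\<Sum>i = 1..t - 1. PA_degree m E i (t - 1) j) = 2 * m * (t - 2) + j"
        using sum_PA_degree[OF val] t by (simp add: numeral_2_eq_2)
      then show ?thesis using t by (simp only: of_nat_add of_nat_mult of_nat_diff) simp
    qed
    then show ?thesis using t by (simp add: sum.distrib of_nat_diff)
  qed
  have Z: "?Z > 0"
    unfolding sum[symmetric] by (rule sum_pos) (use deg t in auto)
  have nonneg: "?w i \<ge> 0" for i
    using deg[of i] Z by (auto simp: attach_weight_def less_imp_le)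
  have w_eq: "?w i = (real (PA_degree m E i (t - 1) j) + \<delta>) / ?Z" if "i \<in> {1..t - 1}" for i
    using that by (simp add: attach_weight_def)
  have w_sum: "(\<Sum>i = 1..t - 1. ?w i) = 1"
  proof -
    have "(\<Sum>i = 1..t - 1. ?w i) = (\<Sum>i = 1..t - 1. (real (PA_degree m E i (t - 1) j) + \<delta>) / ?Z)"
      by (rule sum.cong[OF refl w_eq])
    also have "\<dots> = (\<Sum>i = 1..t - 1. real (PA_degree m E i (t - 1) j) + \<delta>) / ?Z"
      by (rule sum_divide_distrib[symmetric])
    also have "\<dots> = 1" unfolding sum using Z by simp
    finally show ?thesis .
  qed
  have "(\<integral>\<^sup>+ i. ennreal (?w i) \<partial>count_space UNIV) = (\<Sum>i\<in>{1..t - 1}. ennreal (?w i))"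
    by (rule nn_integral_count_space') (auto simp: attach_weight_def split: if_splits)
  also have "\<dots> = 1"
    using nonneg w_sum by (simp add: sum_ennreal)
  finally show ?thesis
    unfolding attach_pmf_def by (rule pmf_embed_pmf[OF nonneg])
qed

lemma valid_attach_edges:
  assumes "1 \<le> m" "\<delta> > - real m" "3 \<le> t" "valid_state m E (t - 1) 0"
    and "F \<in> set_pmf (attach_edges m \<delta> t j E)"
  shows "valid_state m F (t - 1) j"
  using assms(5)
proof (induction j arbitrary: F)
  case 0
  then show ?case using assms(4) by simp
next
  case (Suc j)
  then obtain G i where G: "G \<in> set_pmf (attach_edges m \<delta> t j E)"
    and i: "i \<in> set_pmf (attach_pmf m \<delta> G t (Suc j))"
    and F: "F = G(t := (G t)(Suc j := i))"
    by auto
  have val: "valid_state m G (t - 1) j" by (rule Suc.IH[OF G])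
  have "attach_weight m \<delta> G t (Suc j) i \<noteq> 0"
    using i pmf_attach[OF assms(1-3) val] by (simp add: set_pmf_iff)
  then have "i \<in> {1..<t}"
    using assms(3) by (auto simp: attach_weight_def split: if_splits)
  moreover have "G v l \<in> {1..<v}" if "(v, l) \<in> attached m (t - 1) j" for v l
    using val that unfolding valid_state_def by blast
  ultimately show ?case
    using assms(3) unfolding valid_state_def attached_def F
    by (fastforce simp: le_Suc_eq)
qed

lemma valid_PA:
  assumes "1 \<le> m" "\<delta> > - real m" "2 \<le> t" "E \<in> set_pmf (PA m \<delta> t)"
  shows "valid_state m E t 0"
  using assms(3,4)
proof (induction t arbitrary: E rule: dec_induct)
  case base
  then show ?case by (auto simp: numeral_2_eq_2 valid_state_def attached_def)
next
  case (step n)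
  from step.hyps obtain k where k: "n = Suc (Suc k)"
    by (metis One_nat_def Suc_1 Suc_le_D Suc_le_mono)
  from step.prems obtain G where G: "G \<in> set_pmf (PA m \<delta> n)"
    and E: "E \<in> set_pmf (attach_edges m \<delta> (Suc n) m G)"
    by (auto simp: k)
  have "valid_state m E n m"
    using valid_attach_edges[OF assms(1,2) _ _ E] step.IH[OF G] k by simp
  then show ?case
    using k by (fastforce simp: valid_state_def attached_def le_Suc_eq)
qed

lemma pmf_attach_PA:
  assumes "1 \<le> m" "\<delta> > - real m" "3 \<le> t"
    and "G \<in> set_pmf (PA m \<delta> (t - 1))" "E \<in> set_pmf (attach_edges m \<delta> t j G)"
  shows "pmf (attach_pmf m \<delta> E t (Suc j)) i = attach_weight m \<delta> E t (Suc j) i"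
proof (rule pmf_attach[OF assms(1-3)])
  have "valid_state m G (t - 1) 0" using assms by (intro valid_PA) auto
  then show "valid_state m E (t - 1) j" using valid_attach_edges assms by blast
qed

end

theory Submission
  imports Defs
begin

text \<open>
  The probability that a fixed set \<open>M\<close> of labeled edges is present has an exact product
  formula: the indicator of consistency with \<open>M\<close>, multiplied over all present vertices \<open>u\<close> by
  the rising factorial of \<open>D\<^sub>u + \<delta>\<close> of order the number of edges of \<open>M\<close> still to arrive at
  \<open>u\<close>, is a martingale up to deterministic factors. With \<open>Z\<close> the normalisation and \<open>P\<close> the number
  of pending edges whose target is present, an attachment slot outside \<open>M\<close> contributes
  \<open>1 + P / Z\<close>, a slot in \<open>M\<close> contributes \<open>1 / Z\<close>. As
  \<open>Z \<approx> (2 m + \<delta>) v\<close> at vertex \<open>v\<close>, summing logarithms shows that the probability is of the order of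
  the product of \<open>u powr (- \<theta>) * v powr (\<theta> - 1)\<close> over the edges \<open>v \<rightarrow> u\<close>,
  where \<open>\<theta> = m / (2 m + \<delta>) = 1 / (\<tau> - 1)\<close>.

  Hence the expectation is of the order of the sum over \<open>i\<^sub>1 < \<dots> < i\<^sub>k \<le> t\<close> of the
  product of \<open>i\<^sub>a powr \<beta>\<^sub>a\<close>. Summing from the innermost index outwards, each step
  turns an order \<open>i powr (g - 1) * ln i ^ q\<close> into \<open>t powr g * ln t ^ q\<close>, \<open>ln t ^ (q + 1)\<close> or a constant,
  according to the sign of \<open>g\<close>; the maximal exponent and the number of its maximizers obey the same recursion.
\<close>

section \<open>Ordered sums of powers\<close>

text \<open>Plain telescoping would only bound \<open>G (Suc n) - G K\<close>. Shrinking the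
  constant lets the single term \<open>h K\<close> pay for the initial value, so that
  \<open>G\<close> itself is dominated. Negative increments are harmless since \<open>h\<close> is
  positive.\<close>

lemma sum_compare_telescope:
  fixes G h :: "nat \<Rightarrow> real"
  assumes "\<And>i. i \<ge> 1 \<Longrightarrow> G i > 0" "\<And>i. i \<ge> 1 \<Longrightarrow> h i > 0" "c > 0"
    and "\<And>i. i \<ge> 1 \<Longrightarrow> c * (G (Suc i) - G i) \<le> h i" and K: "K \<ge> 1"
  shows "\<exists>c'>0. \<forall>n\<ge>K. c' * G (Suc n) \<le> (\<Sum>i=K..n. h i)"
proof -
  \<comment> \<open>The second argument of the minimum makes the base case \<open>n = K\<close>
    hold; the first one serves the increments.\<close>
  define c' where "c' = min c (h K / G (Suc K))"
  have c': "c' > 0" using assms(1)[of "Suc K"] assms(2)[of K] assms(3) K by (simp add: c'_def)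
  have "c' * G (Suc n) \<le> (\<Sum>i=K..n. h i)" if "n \<ge> K" for n
    using that
  proof (induction n rule: dec_induct)
    case base
    have "c' * G (Suc K) \<le> (h K / G (Suc K)) * G (Suc K)"
      using assms(1)[of "Suc K"] by (intro mult_right_mono) (auto simp: c'_def)
    then show ?case using assms(1)[of "Suc K"] by simp
  next
    case (step n)
    have "c' * (G (Suc (Suc n)) - G (Suc n)) \<le> h (Suc n)"
    proof (cases "G (Suc (Suc n)) - G (Suc n) \<ge> 0")
      case True
      then have "c' * (G (Suc (Suc n)) - G (Suc n)) \<le> c * (G (Suc (Suc n)) - G (Suc n))"
        by (intro mult_right_mono) (auto simp: c'_def)
      then show ?thesis using assms(4)[of "Suc n"] by simp
    next
      case False
      then have "c' * (G (Suc (Suc n)) - G (Suc n)) \<le> 0" using c' by (simp add: mult_le_0_iff)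
      then show ?thesis using assms(2)[of "Suc n"] by simp
    qed
    then show ?case using step by (simp add: algebra_simps)
  qed
  then show ?thesis using c' by blast
qed

lemma sum_le_telescope:
  fixes G h :: "nat \<Rightarrow> real"
  assumes "G 1 \<ge> 0" "C \<ge> 0" "\<And>i. i \<ge> 1 \<Longrightarrow> h i \<le> C * (G (Suc i) - G i)"
  shows "(\<Sum>i=1..n. h i) \<le> C * G (Suc n)"
proof -
  have "(\<Sum>i=1..n. h i) \<le> C * (G (Suc n) - G 1)"
  proof (induction n)
    case (Suc n)
    have "(\<Sum>i=1..Suc n. h i) = (\<Sum>i=1..n. h i) + h (Suc n)" by simp
    also have "\<dots> \<le> C * (G (Suc n) - G 1) + C * (G (Suc (Suc n)) - G (Suc n))"
      using Suc assms(3)[of "Suc n"] by auto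
    finally show ?case by (simp add: algebra_simps)
  qed simp
  also have "\<dots> \<le> C * G (Suc n)" using assms(1,2) by (intro mult_left_mono) auto
  finally show ?thesis .
qed

text \<open>
  The shift \<open>1 + ln x\<close> keeps this positive at \<open>x = 1\<close>. For the same reason the bounds below are
  stated at \<open>t + 1\<close>, which avoids \<open>0 powr a = 0\<close> and makes the inner sum
  of the recursion, evaluated at \<open>i - 1\<close>, comparable to a function of \<open>i\<close>.
\<close>
definition powlog :: "real \<Rightarrow> nat \<Rightarrow> real \<Rightarrow> real" where
  "powlog g q x = x powr g * (1 + ln x) ^ q"

lemma powlog_pos: "x \<ge> 1 \<Longrightarrow> powlog g q x > 0"
  by (simp add: powlog_def add_pos_nonneg)

lemma powr_compare:
  fixes x y :: real
  assumes "0 < x" "x \<le> y" "y \<le> 2 * x"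
  shows "y powr g \<le> 2 powr \<bar>g\<bar> * x powr g" "x powr g \<le> 2 powr \<bar>g\<bar> * y powr g"
proof -
  have "1 \<le> y / x" "y / x \<le> 2" using assms by (auto simp: field_simps)
  have a: "(y/x) powr g \<le> 2 powr \<bar>g\<bar>"
  proof -
    have "(y/x) powr g \<le> (y/x) powr \<bar>g\<bar>" using \<open>1 \<le> y/x\<close> by (intro powr_mono) auto
    also have "\<dots> \<le> 2 powr \<bar>g\<bar>" using \<open>1 \<le> y/x\<close> \<open>y/x \<le> 2\<close> by (intro powr_mono2) auto
    finally show ?thesis .
  qed
  have b: "(y/x) powr (-g) \<le> 2 powr \<bar>g\<bar>"
  proof -
    have "(y/x) powr (-g) \<le> (y/x) powr \<bar>g\<bar>" using \<open>1 \<le> y/x\<close> by (intro powr_mono) auto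
    also have "\<dots> \<le> 2 powr \<bar>g\<bar>" using \<open>1 \<le> y/x\<close> \<open>y/x \<le> 2\<close> by (intro powr_mono2) auto
    finally show ?thesis .
  qed
  show "y powr g \<le> 2 powr \<bar>g\<bar> * x powr g"
    using a assms by (simp add: powr_divide field_simps)
  show "x powr g \<le> 2 powr \<bar>g\<bar> * y powr g"
    using b assms by (simp add: powr_divide powr_minus field_simps)
qed

text \<open>Within a factor 2 of the argument, \<open>powlog\<close> varies by a bounded factor,
  whatever the sign of \<open>g\<close>. A derivative at an intermediate point of
  \<open>[i, i + 1]\<close> can therefore be exchanged for its value at \<open>i\<close>.\<close>

lemma powlog_compare:
  fixes x y :: real
  assumes "1 \<le> x" "x \<le> y" "y \<le> 2 * x"
  shows "powlog g q y \<le> (2 powr \<bar>g\<bar> * 2 ^ q) * powlog g q x"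
    and "powlog g q x \<le> (2 powr \<bar>g\<bar> * 2 ^ q) * powlog g q y"
proof -
  have "ln y \<le> ln (2 * x)" using assms by simp
  also have "\<dots> = ln 2 + ln x" using assms by (simp add: ln_mult)
  finally have "ln y \<le> ln 2 + ln x" .
  moreover have l0: "0 \<le> ln x" "ln x \<le> ln y" using assms by auto
  ultimately have l: "1 + ln y \<le> 2 * (1 + ln x)" using ln_2_less_1 by (simp add: algebra_simps)
  have "(1 + ln y) ^ q \<le> (2 * (1 + ln x)) ^ q"
    using l l0 by (intro power_mono) auto
  then have 1: "(1 + ln y) ^ q \<le> 2 ^ q * (1 + ln x) ^ q" by (simp only: power_mult_distrib)
  have "(1 + ln x) ^ q \<le> (1 + ln y) ^ q" using l0 by (intro power_mono) auto
  also have "\<dots> \<le> 2 ^ q * (1 + ln y) ^ q" using l0 by simp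
  finally have 2: "(1 + ln x) ^ q \<le> 2 ^ q * (1 + ln y) ^ q" .
  show "powlog g q y \<le> (2 powr \<bar>g\<bar> * 2 ^ q) * powlog g q x"
    using mult_mono[OF powr_compare(1)[of x y g] 1] assms l0 by (simp add: powlog_def ac_simps)
  show "powlog g q x \<le> (2 powr \<bar>g\<bar> * 2 ^ q) * powlog g q y"
    using mult_mono[OF powr_compare(2)[of x y g] 2] assms l0 by (simp add: powlog_def ac_simps)
qed

section \<open>Summation of powers with logarithms\<close>

text \<open>For \<open>q = 0\<close> the truncated exponent \<open>q - 1\<close> does no harm,
  because its coefficient \<open>real q\<close> vanishes.\<close>

lemma powlog_deriv:
  assumes "x \<ge> 1"
  shows "(powlog g q has_real_derivative
     g * powlog (g - 1) q x + real q * powlog (g - 1) (q - 1) x) (at x)"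
proof -
  have "((\<lambda>x. x powr g * (1 + ln x) ^ q) has_real_derivative
     (g * x powr (g - 1)) * (1 + ln x) ^ q + (real q * (1 + ln x) ^ (q - 1) * (1 / x)) * x powr g) (at x)"
    using assms by (auto intro!: derivative_eq_intros)
  moreover have "x powr (g - 1) = x powr g / x"
    using assms by (simp add: powr_diff)
  ultimately show ?thesis
    unfolding powlog_def[abs_def] by (simp add: ac_simps)
qed

lemma powlog_mono_exponent:
  assumes "x \<ge> 1"
  shows "powlog g (q - 1) x \<le> powlog g q x"
  unfolding powlog_def using assms by (intro mult_left_mono power_increasing) auto

text \<open>Mean value theorem on a unit interval. It lets \<open>powlog\<close> act as an
  approximate antiderivative for sums over integers.\<close>

lemma powlog_increment:
  assumes "i \<ge> (1::nat)"
  obtains z where "real i < z" "z < real (Suc i)"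
    "powlog g q (real (Suc i)) - powlog g q (real i)
       = g * powlog (g - 1) q z + real q * powlog (g - 1) (q - 1) z"
proof -
  have "\<exists>z. real i < z \<and> z < real (Suc i) \<and> powlog g q (real (Suc i)) - powlog g q (real i)
       = (real (Suc i) - real i) * (g * powlog (g - 1) q z + real q * powlog (g - 1) (q - 1) z)"
    by (rule MVT2) (use assms in \<open>auto intro!: powlog_deriv simp del: One_nat_def\<close>)
  then show ?thesis using that by auto
qed

text \<open>The logarithmic exponent after integrating
  \<open>x powr (g - 1) * (1 + ln x) ^ q\<close>: kept under divergence as a power, raised by one in
  the critical case, forgotten under convergence.\<close>

definition growth_log_power :: "real \<Rightarrow> nat \<Rightarrow> nat" where
  "growth_log_power g q = (if g > 0 then q else if g = 0 then Suc q else 0)"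

text \<open>The increments of the antiderivative are at most a constant times the summand in all
  three regimes; for \<open>g < 0\<close> the antiderivative is the constant 1. An arbitrary
  starting index is allowed because the lower bound for an inner ordered sum holds only from some
  index on.\<close>

lemma powlog_sum_lower:
  assumes K: "K \<ge> 1"
  shows "\<exists>c>0. \<forall>n\<ge>K. c * powlog (max g 0) (growth_log_power g q) (real (Suc n))
           \<le> (\<Sum>i=K..n. powlog (g - 1) q (real i))"
proof (rule sum_compare_telescope[OF _ _ _ _ K])
  define q' where "q' = growth_log_power g q"
  \<comment> \<open>The first two factors compare the intermediate point with \<open>i\<close>; the
    last one dominates the derivative coefficients \<open>g + q\<close> for \<open>g > 0\<close> and
    \<open>q + 1\<close> for \<open>g = 0\<close>.\<close>
  define D where "D = 2 powr \<bar>g - 1\<bar> * 2 ^ q * (\<bar>g\<bar> + real q + 1)"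
  have D: "D > 0" by (simp add: D_def)
  then show "1 / D > 0" by simp
  fix i :: nat assume i: "i \<ge> 1"
  show "powlog (max g 0) q' (real i) > 0" "powlog (g - 1) q (real i) > 0"
    using i by (auto intro!: powlog_pos)
  obtain z where z: "real i < z" "z < real (Suc i)"
    "powlog (max g 0) q' (real (Suc i)) - powlog (max g 0) q' (real i)
       = max g 0 * powlog (max g 0 - 1) q' z + real q' * powlog (max g 0 - 1) (q' - 1) z"
    using powlog_increment[OF i] by blast
  have z1: "z \<ge> 1" "z \<le> 2 * real i" using i z by auto
  have pos: "powlog (g - 1) q z > 0" using powlog_pos[OF z1(1)] .
  have "max g 0 * powlog (max g 0 - 1) q' z + real q' * powlog (max g 0 - 1) (q' - 1) z
       \<le> (\<bar>g\<bar> + real q + 1) * powlog (g - 1) q z"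
  proof -
    consider "g > 0" | "g = 0" | "g < 0" by linarith
    then show ?thesis
    proof cases
      case 1
      then have "q' = q" by (simp add: q'_def growth_log_power_def)
      moreover have "real q * powlog (g - 1) (q - 1) z \<le> real q * powlog (g - 1) q z"
        using powlog_mono_exponent[OF z1(1)] by (intro mult_left_mono) auto
      ultimately show ?thesis using 1 pos by (simp add: algebra_simps)
    next
      case 2
      then have "q' = Suc q" by (simp add: q'_def growth_log_power_def)
      then show ?thesis using 2 by (simp add: algebra_simps)
    next
      case 3
      then have "q' = 0" by (simp add: q'_def growth_log_power_def)
      then show ?thesis using 3 pos by (simp add: mult_nonneg_nonneg)
    qed
  qed
  also have "\<dots> \<le> (\<bar>g\<bar> + real q + 1) * (2 powr \<bar>g - 1\<bar> * 2 ^ q * powlog (g - 1) q (real i))"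
    using powlog_compare(1)[of "real i" z] i z z1 by (intro mult_left_mono) auto
  also have "\<dots> = D * powlog (g - 1) q (real i)" by (simp add: D_def)
  finally show "1 / D * (powlog (max g 0) q' (real (Suc i)) - powlog (max g 0) q' (real i))
      \<le> powlog (g - 1) q (real i)"
    using D z(3) by (simp add: field_simps)
qed

text \<open>Any positive power of \<open>x\<close> absorbs a power of the logarithm:
  \<open>1 + ln x\<close> is at most a constant times \<open>x powr b\<close>, with \<open>b\<close>
  so small that \<open>q\<close> such factors stay below \<open>x powr a\<close>.\<close>

lemma powlog_le_powr:
  assumes "a > 0"
  shows "\<exists>C>0. \<forall>x\<ge>1. powlog (g - a) q x \<le> C * x powr g"
proof -
  define b where "b = a / (real q + 1)"
  have b: "b > 0" using assms by (simp add: b_def)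
  have "powlog (g - a) q x \<le> (1 + 1 / b) ^ q * x powr g" if x: "x \<ge> 1" for x
  proof -
    have "1 \<le> x powr b" using x b by (simp add: ge_one_powr_ge_zero)
    then have "1 + ln x \<le> (1 + 1 / b) * x powr b"
      using ln_powr_bound[OF x b] by (simp add: algebra_simps)
    then have "(1 + ln x) ^ q \<le> ((1 + 1 / b) * x powr b) ^ q"
      using x by (intro power_mono) auto
    also have "\<dots> = (1 + 1 / b) ^ q * x powr (b * real q)"
      using x by (simp add: power_mult_distrib powr_powr flip: powr_realpow)
    also have "\<dots> \<le> (1 + 1 / b) ^ q * x powr a"
      using x b assms by (intro mult_left_mono powr_mono) (auto simp: b_def field_simps)
    finally have "x powr (g - a) * (1 + ln x) ^ q \<le> x powr (g - a) * ((1 + 1 / b) ^ q * x powr a)"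
      by (intro mult_left_mono) auto
    also have "\<dots> = (1 + 1 / b) ^ q * x powr g"
      using x by (simp add: powr_diff)
    finally show ?thesis by (simp add: powlog_def)
  qed
  moreover have "(1 + 1 / b) ^ q > 0" using b by (simp add: add_pos_pos)
  ultimately show ?thesis by blast
qed

text \<open>For \<open>g >= 0\<close> the antiderivative of the lower bound works again. For
  \<open>g < 0\<close> it is constant and gives nothing, so a bounded increasing function is
  telescoped instead, after half of the decay has been spent on the logarithms.\<close>

lemma powlog_sum_upper:
  "\<exists>C>0. \<forall>n. (\<Sum>i=1..n. powlog (g - 1) q (real i))
      \<le> C * powlog (max g 0) (growth_log_power g q) (real (Suc n))"
proof (cases "g \<ge> 0")
  case True
  define q' where "q' = growth_log_power g q"
  \<comment> \<open>A lower bound for the leading coefficient of the derivative: this coefficient is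
    \<open>g\<close> itself for \<open>g > 0\<close>, and \<open>q + 1\<close> in the critical
    case.\<close>
  define a where "a = (if g > 0 then g else 1)"
  have a: "a > 0" using True by (simp add: a_def)
  define C where "C = 2 powr \<bar>g - 1\<bar> * 2 ^ q / a"
  have C: "C > 0" using a by (simp add: C_def)
  have "(\<Sum>i=1..n. powlog (g - 1) q (real i)) \<le> C * powlog (max g 0) q' (real (Suc n))" for n
  proof (rule sum_le_telescope)
    show "0 \<le> powlog (max g 0) q' (real 1)" using powlog_pos[of "real 1"] by (simp add: less_imp_le)
    show "C \<ge> 0" using C by simp
    fix i :: nat assume i: "i \<ge> 1"
    obtain z where z: "real i < z" "z < real (Suc i)"
      "powlog (max g 0) q' (real (Suc i)) - powlog (max g 0) q' (real i)
         = max g 0 * powlog (max g 0 - 1) q' z + real q' * powlog (max g 0 - 1) (q' - 1) z"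
      using powlog_increment[OF i] by blast
    have z1: "z \<ge> 1" "z \<le> 2 * real i" using i z by auto
    have "a * powlog (g - 1) q z \<le>
        max g 0 * powlog (max g 0 - 1) q' z + real q' * powlog (max g 0 - 1) (q' - 1) z"
    proof (cases "g = 0")
      case True
      then show ?thesis using powlog_pos[OF z1(1), of "-1" q]
        by (simp add: q'_def growth_log_power_def a_def algebra_simps)
    next
      case False
      then show ?thesis using \<open>g \<ge> 0\<close> powlog_pos[OF z1(1), of "g-1" "q-1"]
        by (simp add: q'_def growth_log_power_def a_def)
    qed
    then have "powlog (g - 1) q z \<le>
        (powlog (max g 0) q' (real (Suc i)) - powlog (max g 0) q' (real i)) / a"
      using a z(3) by (simp add: field_simps)
    then have "2 powr \<bar>g - 1\<bar> * 2 ^ q * powlog (g - 1) q z \<le> 2 powr \<bar>g - 1\<bar> * 2 ^ q *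
        ((powlog (max g 0) q' (real (Suc i)) - powlog (max g 0) q' (real i)) / a)"
      by (intro mult_left_mono) auto
    moreover have "powlog (g - 1) q (real i) \<le> 2 powr \<bar>g - 1\<bar> * 2 ^ q * powlog (g - 1) q z"
      using powlog_compare(2)[of "real i" z] i z z1 by auto
    ultimately show "powlog (g - 1) q (real i)
        \<le> C * (powlog (max g 0) q' (real (Suc i)) - powlog (max g 0) q' (real i))"
      by (simp add: C_def)
  qed
  then show ?thesis using C unfolding q'_def by blast
next
  case False
  define b where "b = - g / 2"
  have b: "b > 0" and gb: "- b - 1 - b = g - 1" using False by (auto simp: b_def)
  obtain C0 where C0: "C0 > 0" "\<And>x. x \<ge> 1 \<Longrightarrow> powlog (g - 1) q x \<le> C0 * x powr (- b - 1)"
    using powlog_le_powr[OF b, of "- b - 1" q] gb by auto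
  \<comment> \<open>Its increments are of order \<open>i powr (- b - 1)\<close>, and its values
    never exceed 2, which yields a bound independent of \<open>n\<close>.\<close>
  define G where "G = (\<lambda>i::nat. 2 - real i powr (- b))"
  define C where "C = C0 * (2 powr (b + 1)) / b"
  have C: "C > 0" using C0 b by (simp add: C_def)
  have "(\<Sum>i=1..n. powlog (g - 1) q (real i)) \<le> C * G (Suc n)" for n
  proof (rule sum_le_telescope)
    show "G 1 \<ge> 0" by (simp add: G_def)
    show "C \<ge> 0" using C by simp
    fix i :: nat assume i: "i \<ge> 1"
    obtain z where z: "real i < z" "z < real (Suc i)"
      "powlog (-b) 0 (real (Suc i)) - powlog (-b) 0 (real i) = -b * powlog (-b - 1) 0 z"
      using powlog_increment[OF i, of "-b" 0] by auto
    have z1: "z \<ge> 1" "z \<le> 2 * real i" using i z by auto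
    have GG: "G (Suc i) - G i = b * z powr (-b - 1)"
      using z(3) by (simp add: G_def powlog_def)
    have "powlog (g - 1) q (real i) \<le> C0 * real i powr (- b - 1)" using C0(2) i by simp
    also have "\<dots> \<le> C0 * (2 powr (b + 1) * z powr (- b - 1))"
      using powr_compare(2)[of "real i" z "-b-1"] i z z1 C0 b
      by (intro mult_left_mono) (auto simp: abs_if add.commute)
    also have "\<dots> = C * (G (Suc i) - G i)" using b by (simp add: GG C_def)
    finally show "powlog (g - 1) q (real i) \<le> C * (G (Suc i) - G i)" .
  qed
  moreover have "C * G n \<le> C * 2" for n using C by (intro mult_left_mono) (auto simp: G_def)
  ultimately have "(\<Sum>i=1..n. powlog (g - 1) q (real i)) \<le> C * 2" for n by (meson order_trans)
  moreover have "powlog (max g 0) (growth_log_power g q) (real (Suc n)) = 1" for n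
    using False by (simp add: powlog_def growth_log_power_def)
  ultimately show ?thesis using C by (intro exI[of _ "C*2"]) auto
qed

section \<open>Ordered sums and the recursion for their growth\<close>

text \<open>The outermost index is the largest one; running the inner sum only up to
  \<open>i - 1\<close> makes the indices strictly increasing.\<close>

fun ordered_sum :: "(nat \<Rightarrow> real) \<Rightarrow> nat \<Rightarrow> nat \<Rightarrow> real" where
  "ordered_sum b 0 t = 1"
| "ordered_sum b (Suc k) t = (\<Sum>i=1..t. ordered_sum b k (i - 1) * real i powr b (Suc k))"

text \<open>The exponent of \<open>t\<close> contributed by configurations whose first
  \<open>s\<close> indices stay bounded while the others are of order \<open>t\<close>: each of the
  latter gives 1 for its number of choices and \<open>b i\<close> for its weight.\<close>

definition tail_weight :: "(nat \<Rightarrow> real) \<Rightarrow> nat \<Rightarrow> nat \<Rightarrow> real" where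
  "tail_weight b k s = (\<Sum>i=s+1..k. 1 + b i)"

definition max_tail :: "(nat \<Rightarrow> real) \<Rightarrow> nat \<Rightarrow> real" where
  "max_tail b k = (MAX s\<in>{0..k}. tail_weight b k s)"

definition num_max_tail :: "(nat \<Rightarrow> real) \<Rightarrow> nat \<Rightarrow> nat" where
  "num_max_tail b k = card {s \<in> {0..k}. tail_weight b k s = max_tail b k}"

lemma tail_weight_Suc:
  "s \<le> k \<Longrightarrow> tail_weight b (Suc k) s = tail_weight b k s + (1 + b (Suc k))"
  "tail_weight b (Suc k) (Suc k) = 0"
  by (auto simp: tail_weight_def)

text \<open>A further index shifts all old tail weights by the same amount and adds the empty tail,
  of weight 0.\<close>

lemma max_tail_Suc: "max_tail b (Suc k) = max (max_tail b k + (1 + b (Suc k))) 0"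
proof -
  have "tail_weight b (Suc k) ` {0..Suc k} =
      insert 0 ((\<lambda>x. x + (1 + b (Suc k))) ` (tail_weight b k ` {0..k}))"
    unfolding atLeast0_atMost_Suc image_insert image_image
    by (auto simp: tail_weight_Suc)
  moreover have "Max ((\<lambda>x. x + (1 + b (Suc k))) ` (tail_weight b k ` {0..k}))
     = max_tail b k + (1 + b (Suc k))"
    unfolding max_tail_def by (subst mono_Max_commute) (auto simp: mono_def)
  ultimately show ?thesis unfolding max_tail_def[of b "Suc k"]
    by (simp add: max.commute)
qed

lemma num_max_tail_pos: "num_max_tail b k > 0"
proof -
  have "Max (tail_weight b k ` {0..k}) \<in> tail_weight b k ` {0..k}" by (intro Max_in) auto
  then have "{s \<in> {0..k}. tail_weight b k s = max_tail b k} \<noteq> {}"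
    unfolding max_tail_def by force
  then show ?thesis unfolding num_max_tail_def by (simp add: card_gt_0_iff)
qed

lemma tail_weight_le_max: "s \<le> k \<Longrightarrow> tail_weight b k s \<le> max_tail b k"
  unfolding max_tail_def by (intro Max_ge) auto

text \<open>The empty tail competes with the shifted old maximum: it loses, ties and adds one
  maximizer, or wins alone. These are the three regimes of \<open>growth_log_power\<close>. The
  subtractions of 1 are not truncated, as a maximizer always exists.\<close>

lemma num_max_tail_Suc:
  "num_max_tail b (Suc k) - 1 = growth_log_power (max_tail b k + (1 + b (Suc k))) (num_max_tail b k - 1)"
proof -
  let ?c = "1 + b (Suc k)"
  let ?A = "{s \<in> {0..k}. tail_weight b k s = max_tail b k}"
  let ?B = "{s \<in> {0..Suc k}. tail_weight b (Suc k) s = max_tail b (Suc k)}"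
  have B: "?B = {s \<in> {0..k}. tail_weight b k s + ?c = max_tail b (Suc k)} \<union>
      (if max_tail b (Suc k) = 0 then {Suc k} else {})"
    by (auto simp: tail_weight_Suc le_Suc_eq)
  consider "max_tail b k + ?c > 0" | "max_tail b k + ?c = 0" | "max_tail b k + ?c < 0" by linarith
  then show ?thesis
  proof cases
    case 1
    then have "?B = ?A" unfolding B unfolding max_tail_Suc by auto
    then show ?thesis using 1 by (simp add: growth_log_power_def num_max_tail_def)
  next
    case 2
    then have "?B = insert (Suc k) ?A" unfolding B unfolding max_tail_Suc by auto
    then have "num_max_tail b (Suc k) = Suc (num_max_tail b k)"
      unfolding num_max_tail_def by simp
    then show ?thesis using 2 num_max_tail_pos[of b k] by (simp add: growth_log_power_def)
  next
    case 3
    then have m0: "max_tail b (Suc k) = 0" by (simp add: max_tail_Suc)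
    have "tail_weight b k s + ?c < 0" if "s \<le> k" for s
      using tail_weight_le_max[OF that, of b] 3 by linarith
    then have "?B = {Suc k}" unfolding B unfolding m0 by force
    then show ?thesis using 3 by (simp add: growth_log_power_def num_max_tail_def)
  qed
qed

lemma ordered_sum_nonneg: "ordered_sum b k t \<ge> 0"
  by (induction b k t rule: ordered_sum.induct) (auto intro!: sum_nonneg)

text \<open>The lower bound needs \<open>t >= k\<close>, since for smaller \<open>t\<close> there
  are no \<open>k\<close> increasing indices and the sum is 0. In the induction, the bound for the
  inner sum turns the outer summand into \<open>powlog (g - 1) q\<close>, to which the
  one-dimensional estimates apply.\<close>

lemma ordered_sum_bounds:
  "\<exists>c C. 0 < c \<and> 0 < C \<and>
     (\<forall>t\<ge>k. c * powlog (max_tail b k) (num_max_tail b k - 1) (real (Suc t)) \<le> ordered_sum b k t) \<and>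
     (\<forall>t. ordered_sum b k t \<le> C * powlog (max_tail b k) (num_max_tail b k - 1) (real (Suc t)))"
proof (induction k)
  case 0
  have "max_tail b 0 = 0" "num_max_tail b 0 = 1"
    by (simp_all add: max_tail_def num_max_tail_def tail_weight_def)
  then show ?case by (auto simp: powlog_def intro!: exI[of _ 1])
next
  case (Suc k)
  define A q where "A = max_tail b k" and "q = num_max_tail b k - 1"
  define g where "g = A + (1 + b (Suc k))"
  obtain c C where cC: "0 < c" "0 < C"
    "\<And>t. t \<ge> k \<Longrightarrow> c * powlog A q (real (Suc t)) \<le> ordered_sum b k t"
    "\<And>t. ordered_sum b k t \<le> C * powlog A q (real (Suc t))"
    using Suc.IH unfolding A_def q_def by blast
  have split: "powlog A q (real i) * real i powr b (Suc k) = powlog (g - 1) q (real i)" if "i \<ge> 1" for i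
    using that by (simp add: powlog_def g_def powr_add)
  have eq: "max_tail b (Suc k) = max g 0"
    "num_max_tail b (Suc k) - 1 = growth_log_power g q"
    by (simp_all only: max_tail_Suc num_max_tail_Suc g_def A_def q_def)
  obtain c2 where c2: "c2 > 0" "\<And>n. n \<ge> Suc k \<Longrightarrow>
     c2 * powlog (max g 0) (growth_log_power g q) (real (Suc n)) \<le> (\<Sum>i=Suc k..n. powlog (g - 1) q (real i))"
    using powlog_sum_lower[of "Suc k" g q] by auto
  obtain C2 where C2: "C2 > 0" "\<And>n. (\<Sum>i=1..n. powlog (g - 1) q (real i))
     \<le> C2 * powlog (max g 0) (growth_log_power g q) (real (Suc n))"
    using powlog_sum_upper[of g q] by auto
  have "c * c2 * powlog (max g 0) (growth_log_power g q) (real (Suc t)) \<le> ordered_sum b (Suc k) t"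
    if t: "t \<ge> Suc k" for t
  proof -
    have "c * (c2 * powlog (max g 0) (growth_log_power g q) (real (Suc t)))
        \<le> c * (\<Sum>i=Suc k..t. powlog (g - 1) q (real i))"
      using c2(2)[OF t] cC by (intro mult_left_mono) auto
    also have "\<dots> = (\<Sum>i=Suc k..t. (c * powlog A q (real (Suc (i - 1)))) * real i powr b (Suc k))"
      unfolding sum_distrib_left by (intro sum.cong) (auto simp: split[symmetric])
    also have "\<dots> \<le> (\<Sum>i=Suc k..t. ordered_sum b k (i - 1) * real i powr b (Suc k))"
      by (intro sum_mono mult_right_mono cC) auto
    also have "\<dots> \<le> (\<Sum>i=1..t. ordered_sum b k (i - 1) * real i powr b (Suc k))"
      by (intro sum_mono2) (auto intro!: mult_nonneg_nonneg ordered_sum_nonneg)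
    finally show ?thesis by (simp add: mult.assoc)
  qed
  moreover have "ordered_sum b (Suc k) t \<le> C * C2 * powlog (max g 0) (growth_log_power g q) (real (Suc t))" for t
  proof -
    have "ordered_sum b (Suc k) t
        \<le> (\<Sum>i=1..t. (C * powlog A q (real (Suc (i - 1)))) * real i powr b (Suc k))"
      unfolding ordered_sum.simps by (intro sum_mono mult_right_mono cC) auto
    also have "\<dots> = C * (\<Sum>i=1..t. powlog (g - 1) q (real i))"
      unfolding sum_distrib_left by (intro sum.cong) (auto simp: split[symmetric])
    also have "\<dots> \<le> C * (C2 * powlog (max g 0) (growth_log_power g q) (real (Suc t)))"
      using C2(2)[of t] cC by (intro mult_left_mono) auto
    finally show ?thesis by (simp add: mult.assoc)
  qed
  ultimately show ?case unfolding eq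
    using cC c2 C2 by (intro exI[of _ "c * c2"] exI[of _ "C * C2"]) auto
qed

section \<open>Ordered sums as sums over subsets\<close>

lemma sorted_list_of_set_insert_max:
  assumes "finite S" "\<And>x. x \<in> S \<Longrightarrow> x < (i::nat)"
  shows "sorted_list_of_set (insert i S) = sorted_list_of_set S @ [i]"
proof -
  have "i \<notin> S" using assms by auto
  show ?thesis
    using assms \<open>i \<notin> S\<close> by (simp add: sorted_insort_is_snoc less_imp_le)
qed

text \<open>Splitting off the maximum of a set is inverse to inserting an index above all elements
  of a smaller set, and it leaves the positions of the other elements unchanged.\<close>

lemma ordered_sum_eq:
  "ordered_sum b k t = (\<Sum>S | S \<subseteq> {1..t} \<and> card S = k. \<Prod>a=1..k. real (sorted_list_of_set S ! (a - 1)) powr b a)"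
proof (induction k arbitrary: t)
  case 0
  have "{S. S \<subseteq> {1..t} \<and> card S = 0} = {{}}" by (auto dest: finite_subset)
  then show ?case by simp
next
  case (Suc k)
  let ?f = "\<lambda>k S. \<Prod>a=1..k. real (sorted_list_of_set S ! (a - 1)) powr b a"
  let ?X = "\<lambda>k (t::nat). {S. S \<subseteq> {1..t} \<and> card S = k}"
  have fin: "finite (?X k t)" for k t by (rule finite_subset[of _ "Pow {1..t}"]) auto
  have "ordered_sum b (Suc k) t = (\<Sum>i=1..t. \<Sum>S\<in>?X k (i - 1). ?f k S * real i powr b (Suc k))"
    by (simp add: Suc.IH sum_distrib_right)
  also have "\<dots> = (\<Sum>(i, S)\<in>Sigma {1..t} (\<lambda>i. ?X k (i - 1)). ?f k S * real i powr b (Suc k))"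
    by (rule sum.Sigma) (use fin in auto)
  also have "\<dots> = (\<Sum>S\<in>?X (Suc k) t. ?f (Suc k) S)"
  proof (rule sum.reindex_bij_witness[of _ "\<lambda>S. (Max S, S - {Max S})" "\<lambda>(i, S). insert i S"])
    fix p assume "p \<in> Sigma {1..t} (\<lambda>i. ?X k (i - 1))"
    then obtain i S where p: "p = (i, S)" "i \<in> {1..t}" "S \<subseteq> {1..i - 1}" "card S = k" by auto
    have lt: "x < i" if "x \<in> S" for x using that p by force
    have finS: "finite S" using p finite_subset by blast
    have mx: "Max (insert i S) = i" using lt finS by (intro Max_eqI) (auto simp: less_imp_le)
    have "i \<notin> S" using lt by auto
    then show "(\<lambda>S. (Max S, S - {Max S})) ((\<lambda>(i, S). insert i S) p) = p" by (auto simp: p mx)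
    show "(\<lambda>(i, S). insert i S) p \<in> ?X (Suc k) t"
      using p lt finS \<open>i \<notin> S\<close> by (auto dest!: subsetD)
    have len: "length (sorted_list_of_set S) = k" using p by simp
    show "?f (Suc k) ((\<lambda>(i, S). insert i S) p) = (\<lambda>(i, S). ?f k S * real i powr b (Suc k)) p"
      using sorted_list_of_set_insert_max[OF finS lt] len
      by (auto simp: p nth_append intro!: prod.cong)
  next
    fix S assume S: "S \<in> ?X (Suc k) t"
    have finS: "finite S" "S \<noteq> {}" using S finite_subset by fastforce+
    then have M: "Max S \<in> S" by simp
    then show "(\<lambda>(i, S). insert i S) ((\<lambda>S. (Max S, S - {Max S})) S) = S" by auto
    have "x \<le> Max S - 1" if "x \<in> S - {Max S}" for x
      proof -
      have "x \<le> Max S" "x \<noteq> Max S" using that finS by auto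
      then show ?thesis by linarith
    qed
    moreover have "S \<subseteq> {1..t}" "Max S \<in> {1..t}" using S M by blast+
    ultimately have "S - {Max S} \<subseteq> {1..Max S - 1}" by force
    then show "(\<lambda>S. (Max S, S - {Max S})) S \<in> Sigma {1..t} (\<lambda>i. ?X k (i - 1))"
      using S M finS \<open>Max S \<in> {1..t}\<close> by auto
  qed
  finally show ?case by simp
qed

section \<open>Elementary estimates\<close>

lemma harmonic_ln_bounds:
  assumes "1 \<le> u" "u \<le> (v::nat)"
  shows "ln (real v / real u) \<le> (\<Sum>i=u..<v. 1 / real i)"
    and "(\<Sum>i=u..<v. 1 / real i) \<le> ln (real v / real u) + 1"
proof -
  have incr: "ln (real (Suc n)) - ln (real n) \<le> 1 / real n"
    "1 / real n - 1 / real (Suc n) \<ge> 1 / real n - (ln (real (Suc n)) - ln (real n))" if "n \<ge> 1" for n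
  proof -
    have "ln (real (Suc n)) - ln (real n) = ln (real (Suc n) / real n)"
      using that by (subst ln_div) auto
    also have "real (Suc n) / real n = 1 + 1 / real n" using that by (simp add: field_simps)
    finally have "ln (real (Suc n)) - ln (real n) = ln (1 + 1 / real n)" .
    then show "ln (real (Suc n)) - ln (real n) \<le> 1 / real n"
      using ln_add_one_self_le_self[of "1 / real n"] by simp
    have "ln (real n) - ln (real (Suc n)) = ln (real n / real (Suc n))"
      using that by (subst ln_div) auto
    also have "\<dots> \<le> real n / real (Suc n) - 1" using that by (intro ln_le_minus_one) auto
    also have "\<dots> = - 1 / real (Suc n)" by (simp add: field_simps)
    finally show "1 / real n - 1 / real (Suc n) \<ge> 1 / real n - (ln (real (Suc n)) - ln (real n))" by simp
  qed
  \<comment> \<open>The sharper error \<open>1 / u - 1 / v\<close> is what telescopes in the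
    induction; it is weakened to 1 afterwards.\<close>
  have "ln (real v) - ln (real u) \<le> (\<Sum>i=u..<v. 1 / real i) \<and>
    (\<Sum>i=u..<v. 1 / real i) \<le> ln (real v) - ln (real u) + (1 / real u - 1 / real v)"
    using assms(2)
  proof (induction v rule: dec_induct)
    case (step n)
    have "n \<ge> 1" using step assms by simp
    from step.IH incr[OF this] step.hyps
    show ?case by (simp only: sum.atLeastLessThan_Suc) linarith
  qed simp
  moreover have "1 / real u \<le> 1" "1 / real v \<ge> 0" using assms by auto
  ultimately have "ln (real v) - ln (real u) \<le> (\<Sum>i=u..<v. 1 / real i)"
    "(\<Sum>i=u..<v. 1 / real i) \<le> ln (real v) - ln (real u) + 1" by linarith+
  then show "ln (real v / real u) \<le> (\<Sum>i=u..<v. 1 / real i)"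
    "(\<Sum>i=u..<v. 1 / real i) \<le> ln (real v / real u) + 1"
    using assms by (auto simp: ln_div)
qed

lemma sum_inverse_squares_le: "(\<Sum>i=2..<t. 1 / (real i)\<^sup>2) \<le> 1"
proof -
  have "(\<Sum>i=2..<Suc (Suc n). 1 / (real i)\<^sup>2) \<le> 1 - 1 / real (Suc n)" for n
  proof (induction n)
    case (Suc n)
    have "1 / (real (Suc (Suc n)))\<^sup>2 \<le> 1 / real (Suc n) - 1 / real (Suc (Suc n))"
    proof -
      have "1 / (real (Suc (Suc n)))\<^sup>2 \<le> 1 / (real (Suc n) * real (Suc (Suc n)))"
        unfolding power2_eq_square by (intro divide_left_mono mult_right_mono mult_pos_pos) auto
      also have "\<dots> = 1 / real (Suc n) - 1 / real (Suc (Suc n))" by (simp add: field_simps)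
      finally show ?thesis .
    qed
    then show ?case using Suc by (simp add: numeral_2_eq_2)
  qed simp
  then have a: "(\<Sum>i=2..<Suc (Suc n). 1 / (real i)\<^sup>2) \<le> 1" for n
    by (smt (verit) divide_nonneg_nonneg of_nat_0_le_iff)
  show ?thesis
  proof (cases "t \<ge> 2")
    case True
    then obtain n where "t = Suc (Suc n)" by (metis add_2_eq_Suc le_Suc_ex)
    then show ?thesis using a by simp
  qed simp
qed

lemma ln_one_plus_bounds:
  fixes x :: real assumes "x \<ge> 0" shows "\<bar>ln (1 + x) - x\<bar> \<le> x\<^sup>2"
proof (cases "x \<le> 1")
  case True
  then show ?thesis using abs_ln_one_plus_x_minus_x_bound_nonneg assms by simp
next
  case False
  then have "x \<le> x\<^sup>2" by (simp add: power2_eq_square)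
  moreover have "0 \<le> ln (1 + x)" "ln (1 + x) \<le> x" using assms by (auto intro: ln_add_one_self_le_self)
  ultimately show ?thesis by linarith
qed

text \<open>Bounds by \<open>p\<close>-th powers, rather than by constants, can be multiplied over
  all vertices: the orders \<open>p\<close> add up to at most the number of edges, so the product
  stays bounded uniformly in \<open>t\<close>.\<close>

lemma pochhammer_bounds:
  fixes x :: real
  assumes "x > 0" "p \<le> n"
  shows "min 1 x ^ p \<le> pochhammer x p" "pochhammer x p \<le> (x + real n + 1) ^ p"
proof -
  have "min 1 x ^ p = (\<Prod>i<p. min 1 x)" by simp
  also have "\<dots> \<le> (\<Prod>i<p. x + real i)" using assms by (intro prod_mono) auto
  finally show "min 1 x ^ p \<le> pochhammer x p" by (simp add: pochhammer_prod atLeast0LessThan)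
  have "(\<Prod>i<p. x + real i) \<le> (\<Prod>i<p. x + real n + 1)" using assms by (intro prod_mono) auto
  then show "pochhammer x p \<le> (x + real n + 1) ^ p" by (simp add: pochhammer_prod atLeast0LessThan)
qed

section \<open>The probability of containing given edges\<close>

text \<open>A set violating \<open>functional_M\<close> asks one out-edge to have two targets and is
  contained in no realisation, so the product formula concerns only the remaining sets.\<close>

locale PA_edges =
  fixes m :: nat and \<delta> :: real and M :: "(nat \<times> nat \<times> nat) set"
  assumes m_pos: "1 \<le> m" and \<delta>_gt: "\<delta> > - real m" and finite_M: "finite M"
    and edge_in_M: "(u, v, l) \<in> M \<Longrightarrow> 1 \<le> u \<and> u < v \<and> l \<in> {1..m}"
    and functional_M: "(u, v, l) \<in> M \<Longrightarrow> (u', v, l) \<in> M \<Longrightarrow> u = u'"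
begin

section \<open>A potential with deterministic step factors\<close>

definition pending :: "nat \<Rightarrow> nat \<Rightarrow> nat \<Rightarrow> nat" where
  "pending n j u = card {(v, l). (u, v, l) \<in> M \<and> (v, l) \<notin> attached m n j}"

definition pending_total :: "nat \<Rightarrow> nat \<Rightarrow> nat" where
  "pending_total n j = (\<Sum>u=1..n. pending n j u)"

text \<open>The denominator of the attachment rule for slot \<open>Suc j\<close> of vertex
  \<open>Suc n\<close>. Time is indexed by the \<open>n\<close> completed vertices and the
  \<open>j\<close> edges of the next one.\<close>

definition total_weight :: "nat \<Rightarrow> nat \<Rightarrow> real" where
  "total_weight n j = 2 * real m * (real n - 1) + real j + real n * \<delta>"

definition consistent :: "nat \<Rightarrow> nat \<Rightarrow> targets \<Rightarrow> bool" where
  "consistent n j E \<longleftrightarrow> (\<forall>(u, v, l)\<in>M. (v, l) \<in> attached m n j \<longrightarrow> E v l = u)"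

text \<open>
  A slot that is not prescribed by \<open>M\<close> raises the degree of \<open>u\<close> with probability proportional to
  \<open>x = D\<^sub>u + \<delta>\<close>, and the rising factorial of order \<open>p\<close> satisfies
  \<open>pochhammer (x + 1) p / pochhammer x p = (x + p) / x\<close>. The random factor \<open>x\<close> cancels, so
  the conditional expectation of the potential is multiplied by a deterministic \<open>step_factor\<close>.
\<close>
definition potential :: "nat \<Rightarrow> nat \<Rightarrow> targets \<Rightarrow> real" where
  "potential n j E = (if consistent n j E
     then \<Prod>u=1..n. pochhammer (real (PA_degree m E u n j) + \<delta>) (pending n j u) else 0)"

text \<open>On a slot in \<open>M\<close> the two factors multiply to
  \<open>1 / total_weight n j\<close>. This splitting lets \<open>1 + P / Z\<close> run over all
  slots, where logarithms apply, and leaves one further factor for each prescribed slot.\<close>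

definition step_factor :: "nat \<Rightarrow> nat \<Rightarrow> real" where
  "step_factor n j = (1 + real (pending_total n j) / total_weight n j) *
     (if \<exists>u. (u, Suc n, Suc j) \<in> M then 1 / (total_weight n j + real (pending_total n j)) else 1)"

lemma attached_Suc: "attached m n (Suc j) = insert (Suc n, Suc j) (attached m n j)"
  by (auto simp: attached_def)

lemma Suc_notin_attached: "(Suc n, Suc j) \<notin> attached m n j"
  by (auto simp: attached_def)

lemma finite_pending: "finite {(v, l). (u, v, l) \<in> M \<and> P v l}"
proof -
  have "{(v, l). (u, v, l) \<in> M \<and> P v l} \<subseteq> snd ` M" by force
  then show ?thesis using finite_M finite_subset by blast
qed

lemma pending_Suc:
  "pending n j u = pending n (Suc j) u + (if (u, Suc n, Suc j) \<in> M then 1 else 0)"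
proof -
  have "{(v, l). (u, v, l) \<in> M \<and> (v, l) \<notin> attached m n j} =
      (if (u, Suc n, Suc j) \<in> M then {(Suc n, Suc j)} else {}) \<union>
      {(v, l). (u, v, l) \<in> M \<and> (v, l) \<notin> attached m n (Suc j)}"
    using Suc_notin_attached[of n j] by (auto simp: attached_Suc split: if_splits)
  then have "pending n j u = card ((if (u, Suc n, Suc j) \<in> M then {(Suc n, Suc j)} else {}) \<union>
      {(v, l). (u, v, l) \<in> M \<and> (v, l) \<notin> attached m n (Suc j)})"
    by (simp only: pending_def)
  also have "\<dots> = card (if (u, Suc n, Suc j) \<in> M then {(Suc n, Suc j)} else {}) + pending n (Suc j) u"
    unfolding pending_def
    by (rule card_Un_disjoint) (use finite_pending[of u] in \<open>auto simp: attached_Suc\<close>)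
  finally show ?thesis by simp
qed

text \<open>Restricted to older vertices because the out-degree of \<open>Suc n\<close> grows as
  well.\<close>

lemma PA_degree_update:
  assumes "u \<in> {1..n}"
  shows "PA_degree m (E(Suc n := (E (Suc n))(Suc j := i))) u n (Suc j)
       = PA_degree m E u n j + (if u = i then 1 else 0)"
proof -
  let ?E' = "E(Suc n := (E (Suc n))(Suc j := i))"
  have same: "?E' v l = E v l" if "(v, l) \<in> attached m n j" for v l
    using that Suc_notin_attached[of n j] by (auto simp: fun_upd_def)
  have 1: "{(v, l) \<in> attached m n (Suc j). ?E' v l = u} =
     (if u = i then {(Suc n, Suc j)} else {}) \<union> {(v, l) \<in> attached m n j. E v l = u}"
    unfolding attached_Suc using same by (auto split: if_splits)
  have c1: "card {(v, l) \<in> attached m n (Suc j). ?E' v l = u} =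
     (if u = i then 1 else 0) + card {(v, l) \<in> attached m n j. E v l = u}"
    unfolding 1 by (subst card_Un_disjoint) (use Suc_notin_attached in auto)
  have 2: "{(v, l) \<in> attached m n (Suc j). v = u} = {(v, l) \<in> attached m n j. v = u}"
    using assms by (auto simp: attached_Suc)
  show ?thesis unfolding PA_degree_def c1 2 by simp
qed

lemma consistent_update:
  "consistent n (Suc j) (E(Suc n := (E (Suc n))(Suc j := i))) \<longleftrightarrow>
     consistent n j E \<and> (\<forall>u. (u, Suc n, Suc j) \<in> M \<longrightarrow> u = i)"
proof -
  let ?E' = "E(Suc n := (E (Suc n))(Suc j := i))"
  have same: "?E' v l = E v l" if "(v, l) \<in> attached m n j" for v l
    using that Suc_notin_attached[of n j] by (auto simp: fun_upd_def)
  show ?thesis unfolding consistent_def attached_Suc using same by fastforce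
qed

lemma weight_sum:
  assumes "valid_state m E n j" "2 \<le> n"
  shows "(\<Sum>i=1..n. real (PA_degree m E i n j) + \<delta>) = total_weight n j"
proof -
  have "real (\<Sum>i=1..n. PA_degree m E i n j) = 2 * real m * (real n - 1) + real j"
    unfolding sum_PA_degree[OF assms] using assms(2) by (simp add: of_nat_diff)
  then show ?thesis by (simp add: sum.distrib total_weight_def)
qed

lemma weight_pos:
  assumes "valid_state m E n j" "2 \<le> n" "i \<in> {1..n}"
  shows "real (PA_degree m E i n j) + \<delta> > 0"
  using PA_degree_ge[OF assms(1) assms(3) assms(2)] \<delta>_gt by linarith

lemma total_weight_ge:
  assumes "2 \<le> n"
  shows "total_weight n j \<ge> (real m + \<delta>) * real n"
proof -
  have "real m * (real n - 2) \<ge> 0" using assms by simp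
  then show ?thesis by (simp add: total_weight_def algebra_simps)
qed

lemma total_weight_pos: "2 \<le> n \<Longrightarrow> total_weight n j > 0"
  using total_weight_ge[of n j] \<delta>_gt mult_pos_pos[of "real m + \<delta>" "real n"] by linarith

lemma potential_nonneg:
  assumes "valid_state m E n j" "2 \<le> n"
  shows "potential n j E \<ge> 0"
  unfolding potential_def
  by (auto intro!: prod_nonneg pochhammer_nonneg weight_pos[OF assms])

lemma pochhammer_shift:
  fixes x :: real
  assumes "x > 0"
  shows "pochhammer (x + 1) p = pochhammer x p * ((x + real p) / x)"
proof -
  have "x * pochhammer (x + 1) p = pochhammer x p * (x + real p)"
    using pochhammer_rec[of x p] pochhammer_rec'[of x p] by (simp add: ac_simps)
  then show ?thesis using assms by (simp add: field_simps)
qed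

text \<open>On a free slot, the target probabilities weighted by \<open>(x + p) / x\<close> sum to
  \<open>(Z + P) / Z\<close>. On a prescribed slot only the prescribed target \<open>w\<close> keeps
  consistency; there \<open>x w * pochhammer (x w + 1) p = pochhammer (x w) (p + 1)\<close> restores
  the old potential, since exactly one edge ceases to be pending at \<open>w\<close>.\<close>

lemma potential_step_sum:
  assumes val: "valid_state m E n j" and n: "2 \<le> n"
  shows "(\<Sum>i=1..n. (real (PA_degree m E i n j) + \<delta>) / total_weight n j *
            potential n (Suc j) (E(Suc n := (E (Suc n))(Suc j := i))))
         = potential n j E * step_factor n j"
proof (cases "consistent n j E")
  case False
  then show ?thesis by (simp add: potential_def consistent_update)
next
  case True
  define x where "x = (\<lambda>u. real (PA_degree m E u n j) + \<delta>)"
  have x_pos: "x u > 0" if "u \<in> {1..n}" for u using weight_pos[OF val n that] by (simp add: x_def)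
  let ?Z = "total_weight n j"
  have Z: "?Z > 0" using total_weight_pos[OF n] .
  have pot: "potential n j E = (\<Prod>u=1..n. pochhammer (x u) (pending n j u))"
    using True by (simp add: potential_def x_def)
  have pot': "potential n (Suc j) (E(Suc n := (E (Suc n))(Suc j := i))) =
     (if \<forall>u. (u, Suc n, Suc j) \<in> M \<longrightarrow> u = i
      then pochhammer (x i + 1) (pending n (Suc j) i) * (\<Prod>u\<in>{1..n}-{i}. pochhammer (x u) (pending n (Suc j) u)) else 0)"
    if i: "i \<in> {1..n}" for i
  proof -
    have "(\<Prod>u=1..n. pochhammer (real (PA_degree m (E(Suc n := (E (Suc n))(Suc j := i))) u n (Suc j)) + \<delta>) (pending n (Suc j) u))
      = (\<Prod>u=1..n. pochhammer (x u + (if u = i then 1 else 0)) (pending n (Suc j) u))"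
      by (rule prod.cong) (auto simp: PA_degree_update x_def ac_simps)
    also have "\<dots> = pochhammer (x i + 1) (pending n (Suc j) i) * (\<Prod>u\<in>{1..n}-{i}. pochhammer (x u) (pending n (Suc j) u))"
      using i by (subst prod.remove[of _ i]) (auto intro!: prod.cong)
    finally show ?thesis using True by (auto simp: potential_def consistent_update)
  qed
  show ?thesis
  proof (cases "\<exists>u. (u, Suc n, Suc j) \<in> M")
    case noM: False
    then have p: "pending n (Suc j) u = pending n j u" for u
      using pending_Suc[of n j u] by simp
    have tm: "x i / ?Z * potential n (Suc j) (E(Suc n := (E (Suc n))(Suc j := i)))
        = potential n j E * ((x i + real (pending n j i)) / ?Z)" if i: "i \<in> {1..n}" for i
    proof -
      have "potential n j E = pochhammer (x i) (pending n j i) * (\<Prod>u\<in>{1..n}-{i}. pochhammer (x u) (pending n j u))"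
        unfolding pot using i by (subst prod.remove[of _ i]) auto
      then show ?thesis
        unfolding pot'[OF i] p pochhammer_shift[OF x_pos[OF i]] using noM x_pos[OF i] by simp
    qed
    have "(\<Sum>i=1..n. x i / ?Z * potential n (Suc j) (E(Suc n := (E (Suc n))(Suc j := i))))
        = (\<Sum>i=1..n. potential n j E * ((x i + real (pending n j i)) / ?Z))"
      by (intro sum.cong tm) auto
    also have "\<dots> = potential n j E * ((\<Sum>i=1..n. x i + real (pending n j i)) / ?Z)"
      by (simp add: sum_distrib_left sum_divide_distrib)
    also have "(\<Sum>i=1..n. x i + real (pending n j i)) = ?Z + real (pending_total n j)"
      using weight_sum[OF val n] by (simp add: sum.distrib x_def pending_total_def)
    also have "(?Z + real (pending_total n j)) / ?Z = step_factor n j"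
      using noM Z by (simp add: step_factor_def field_simps)
    finally show ?thesis unfolding x_def .
  next
    case True
    then obtain w where w: "(w, Suc n, Suc j) \<in> M" by blast
    have wn: "w \<in> {1..n}" using edge_in_M[OF w] by auto
    have uniq: "(u, Suc n, Suc j) \<in> M \<longleftrightarrow> u = w" for u using functional_M w by blast
    have tm: "x i / ?Z * potential n (Suc j) (E(Suc n := (E (Suc n))(Suc j := i)))
        = (if i = w then potential n j E / ?Z else 0)" if i: "i \<in> {1..n}" for i
    proof (cases "i = w")
      case True
      have "potential n j E = pochhammer (x w) (pending n j w) * (\<Prod>u\<in>{1..n}-{w}. pochhammer (x u) (pending n j u))"
        unfolding pot using wn by (subst prod.remove[of _ w]) auto
      also have "pochhammer (x w) (pending n j w) = x w * pochhammer (x w + 1) (pending n (Suc j) w)"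
        using pending_Suc[of n j w] w by (simp add: pochhammer_rec)
      also have "(\<Prod>u\<in>{1..n}-{w}. pochhammer (x u) (pending n j u)) = (\<Prod>u\<in>{1..n}-{w}. pochhammer (x u) (pending n (Suc j) u))"
        by (intro prod.cong) (auto simp: pending_Suc[of n j] uniq)
      finally show ?thesis using True i by (simp add: pot' uniq)
    next
      case False
      then show ?thesis using i w by (auto simp: pot' uniq)
    qed
    have "(\<Sum>i=1..n. x i / ?Z * potential n (Suc j) (E(Suc n := (E (Suc n))(Suc j := i))))
        = (\<Sum>i=1..n. if i = w then potential n j E / ?Z else 0)"
      by (intro sum.cong tm) auto
    also have "\<dots> = potential n j E / ?Z" using wn by simp
    also have "\<dots> = potential n j E * step_factor n j"
    proof -
      have "?Z + real (pending_total n j) > 0" using Z by simp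
      then show ?thesis using True Z by (simp add: step_factor_def field_simps)
    qed
    finally show ?thesis unfolding x_def .
  qed
qed

text \<open>Nonnegative integrals make the iterated conditional expectations free of integrability
  conditions. Negative values of the potential cannot occur in reachable states.\<close>

lemma nn_integral_step:
  assumes val: "valid_state m E n j" and n: "2 \<le> n"
  shows "(\<integral>\<^sup>+i. ennreal (potential n (Suc j) (E(Suc n := (E (Suc n))(Suc j := i)))) \<partial>attach_pmf m \<delta> E (Suc n) (Suc j))
      = ennreal (potential n j E * step_factor n j)"
proof -
  let ?E = "\<lambda>i. E(Suc n := (E (Suc n))(Suc j := i))"
  let ?w = "\<lambda>i. (real (PA_degree m E i n j) + \<delta>) / total_weight n j"
  have pmf: "pmf (attach_pmf m \<delta> E (Suc n) (Suc j)) i = (if i \<in> {1..n} then ?w i else 0)" for i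
    using pmf_attach[OF m_pos \<delta>_gt, of "Suc n" E j i] val n
    by (simp add: attach_weight_def total_weight_def)
  have val': "valid_state m (?E i) n (Suc j)" if "i \<in> {1..n}" for i
    using val that unfolding valid_state_def attached_Suc
    by (fastforce simp: fun_upd_def)
  have "(\<integral>\<^sup>+i. ennreal (potential n (Suc j) (?E i)) \<partial>attach_pmf m \<delta> E (Suc n) (Suc j))
     = (\<integral>\<^sup>+i. ennreal (pmf (attach_pmf m \<delta> E (Suc n) (Suc j)) i) * ennreal (potential n (Suc j) (?E i)) \<partial>count_space UNIV)"
    by (rule nn_integral_measure_pmf)
  also have "\<dots> = (\<Sum>i\<in>{1..n}. ennreal (pmf (attach_pmf m \<delta> E (Suc n) (Suc j)) i) * ennreal (potential n (Suc j) (?E i)))"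
    by (rule nn_integral_count_space') (auto simp: pmf)
  also have "\<dots> = (\<Sum>i\<in>{1..n}. ennreal (?w i * potential n (Suc j) (?E i)))"
    using weight_pos[OF val n] total_weight_pos[OF n, of j] val' n
    by (intro sum.cong refl)
      (auto simp: pmf potential_nonneg less_imp_le simp del: times_divide_eq_left intro!: ennreal_mult[symmetric])
  also have "\<dots> = ennreal (\<Sum>i\<in>{1..n}. ?w i * potential n (Suc j) (?E i))"
    using weight_pos[OF val n] total_weight_pos[OF n] val' n
    by (intro sum_ennreal mult_nonneg_nonneg potential_nonneg divide_nonneg_nonneg) (auto simp: less_imp_le)
  finally show ?thesis unfolding potential_step_sum[OF val n] .
qed

lemma step_factor_pos: "2 \<le> n \<Longrightarrow> step_factor n j > 0"
  using total_weight_pos[of n j] by (auto simp: step_factor_def intro!: mult_pos_pos divide_pos_pos add_pos_nonneg)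

lemma nn_integral_attach_edges:
  assumes val: "valid_state m E n 0" and n: "2 \<le> n"
  shows "(\<integral>\<^sup>+F. ennreal (potential n j F) \<partial>attach_edges m \<delta> (Suc n) j E)
      = ennreal (potential n 0 E * (\<Prod>i<j. step_factor n i))"
proof (induction j)
  case 0
  then show ?case by (simp add: nn_integral_return)
next
  case (Suc j)
  have "(\<integral>\<^sup>+F. ennreal (potential n (Suc j) F) \<partial>attach_edges m \<delta> (Suc n) (Suc j) E)
     = (\<integral>\<^sup>+F. (\<integral>\<^sup>+i. ennreal (potential n (Suc j) (F(Suc n := (F (Suc n))(Suc j := i)))) \<partial>attach_pmf m \<delta> F (Suc n) (Suc j)) \<partial>attach_edges m \<delta> (Suc n) j E)"
    by simp
  also have "\<dots> = (\<integral>\<^sup>+F. ennreal (potential n j F * step_factor n j) \<partial>attach_edges m \<delta> (Suc n) j E)"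
    using valid_attach_edges[OF m_pos \<delta>_gt, of "Suc n" E _ j] val n
    by (intro nn_integral_cong_AE AE_pmfI nn_integral_step) auto
  also have "\<dots> = (\<integral>\<^sup>+F. ennreal (potential n j F) \<partial>attach_edges m \<delta> (Suc n) j E) * ennreal (step_factor n j)"
    using step_factor_pos[OF n, of j]
    by (subst nn_integral_multc[symmetric]) (auto simp: ennreal_mult'')
  also have "\<dots> = ennreal (potential n 0 E * (\<Prod>i<Suc j. step_factor n i))"
    unfolding Suc.IH using step_factor_pos[OF n, of j]
    by (subst ennreal_mult''[symmetric]) (auto simp: mult.assoc less_imp_le)
  finally show ?case .
qed

text \<open>
  Vertices 1 and 2 both enter in \<open>PA\<^sub>2\<close> with degree \<open>m\<close>, after the edges of
  vertex 2 have been attached, whence the maximum with 2.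
\<close>
definition initial_factor :: "nat \<Rightarrow> real" where
  "initial_factor u = pochhammer (real m + \<delta>) (pending (max u 2) 0 u)"

lemma attached_complete: "1 \<le> n \<Longrightarrow> attached m (Suc n) 0 = attached m n m"
  by (auto simp: attached_def)

text \<open>When vertex \<open>Suc n\<close> is complete it joins the product with degree
  \<open>m\<close>: it has its own \<open>m\<close> out-edges, and no edge points to it yet. All
  other factors are unchanged.\<close>

lemma potential_complete:
  assumes val: "valid_state m E n m" and n: "2 \<le> n"
  shows "potential (Suc n) 0 E = potential n m E * initial_factor (Suc n)"
proof -
  have att: "attached m (Suc n) 0 = attached m n m" using n by (intro attached_complete) auto
  have deg: "PA_degree m E u (Suc n) 0 = PA_degree m E u n m" for u
    unfolding PA_degree_def att ..
  have none: "{(v, l) \<in> attached m n m. E v l = Suc n} = {}"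
    using val unfolding valid_state_def by (fastforce simp: attached_def)
  have "{(v, l) \<in> attached m n m. v = Suc n} = {Suc n} \<times> {1..m}" using n by (auto simp: attached_def)
  then have "PA_degree m E (Suc n) n m = m" unfolding PA_degree_def none
    by (simp add: card_cartesian_product)
  moreover have "consistent (Suc n) 0 E = consistent n m E" unfolding consistent_def att ..
  moreover have "pending (Suc n) 0 u = pending n m u" for u unfolding pending_def att ..
  ultimately show ?thesis using n
    by (simp add: potential_def initial_factor_def deg max_def)
qed

lemma initial_factor_pos: "initial_factor u > 0"
  unfolding initial_factor_def using \<delta>_gt by (intro pochhammer_pos) linarith

lemma nn_integral_PA:
  assumes "2 \<le> n"
  shows "(\<integral>\<^sup>+E. ennreal (potential n 0 E) \<partial>PA m \<delta> n)
      = ennreal ((\<Prod>u=1..n. initial_factor u) * (\<Prod>i=2..<n. \<Prod>j<m. step_factor i j))"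
  using assms
proof (induction n rule: dec_induct)
  case base
  define E :: targets where "E = (\<lambda>v j. if v = 2 \<and> j \<in> {1..m} then 1 else 0 :: nat)"
  have att: "attached m 2 0 = {2} \<times> {1..m}" by (auto simp: attached_def)
  \<comment> \<open>Edges of \<open>M\<close> that leave vertex 2 can only end at 1, as the
    deterministic initial graph requires.\<close>
  have cons: "consistent 2 0 E"
    unfolding consistent_def att using edge_in_M by (fastforce simp: E_def)
  have s12: "{1..2} = {1, 2::nat}" by auto
  have "{(v, l) \<in> {2::nat} \<times> {1..m}. E v l = 1} = {2::nat} \<times> {1..m}"
    "{(v, l) \<in> {2::nat} \<times> {1..m}. v = 1} = {}" "{(v, l) \<in> {2::nat} \<times> {1..m}. E v l = 2} = {}"
    "{(v, l) \<in> {2::nat} \<times> {1..m}. v = 2} = {2::nat} \<times> {1..m}" by (auto simp: E_def)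
  then have "PA_degree m E 1 2 0 = m" "PA_degree m E 2 2 0 = m"
    unfolding PA_degree_def att by (simp_all only: card_cartesian_product) auto
  then have "potential 2 0 E = (\<Prod>u=1..2. initial_factor u)"
    using cons unfolding potential_def s12 initial_factor_def by (simp add: numeral_2_eq_2)
  then show ?case by (simp add: numeral_2_eq_2 nn_integral_return E_def)
next
  case (step n)
  from step.hyps obtain k where k: "n = Suc (Suc k)"
    by (metis One_nat_def Suc_1 Suc_le_D Suc_le_mono)
  have PA: "PA m \<delta> (Suc n) = bind_pmf (PA m \<delta> n) (attach_edges m \<delta> (Suc n) m)" by (simp add: k)
  have val0: "valid_state m G n 0" if "G \<in> set_pmf (PA m \<delta> n)" for G
    using valid_PA[OF m_pos \<delta>_gt step.hyps(1) that] .
  let ?f = "\<Prod>j<m. step_factor n j"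
  have f: "?f > 0" using step_factor_pos[OF step.hyps(1)] by (intro prod_pos) auto
  have "(\<integral>\<^sup>+E. ennreal (potential (Suc n) 0 E) \<partial>PA m \<delta> (Suc n))
     = (\<integral>\<^sup>+G. (\<integral>\<^sup>+E. ennreal (potential (Suc n) 0 E) \<partial>attach_edges m \<delta> (Suc n) m G) \<partial>PA m \<delta> n)"
    unfolding PA by simp
  also have "\<dots> = (\<integral>\<^sup>+G. ennreal (potential n 0 G) * ennreal (?f * initial_factor (Suc n)) \<partial>PA m \<delta> n)"
  proof (intro nn_integral_cong_AE AE_pmfI)
    fix G assume G: "G \<in> set_pmf (PA m \<delta> n)"
    have "(\<integral>\<^sup>+E. ennreal (potential (Suc n) 0 E) \<partial>attach_edges m \<delta> (Suc n) m G)
      = (\<integral>\<^sup>+E. ennreal (potential n m E) * ennreal (initial_factor (Suc n)) \<partial>attach_edges m \<delta> (Suc n) m G)"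
    proof (intro nn_integral_cong_AE AE_pmfI)
      fix E assume "E \<in> set_pmf (attach_edges m \<delta> (Suc n) m G)"
      then have "valid_state m E n m"
        using valid_attach_edges[OF m_pos \<delta>_gt, of "Suc n" G E m] val0[OF G] step.hyps by simp
      then show "ennreal (potential (Suc n) 0 E) = ennreal (potential n m E) * ennreal (initial_factor (Suc n))"
        using potential_complete[OF _ step.hyps(1)] initial_factor_pos[of "Suc n"]
        by (simp add: ennreal_mult'' less_imp_le)
    qed
    also have "\<dots> = ennreal (potential n 0 G * ?f) * ennreal (initial_factor (Suc n))"
      by (subst nn_integral_multc) (auto simp: nn_integral_attach_edges[OF val0[OF G] step.hyps(1)])
    also have "\<dots> = ennreal (potential n 0 G) * ennreal (?f * initial_factor (Suc n))"
      using f initial_factor_pos[of "Suc n"] by (simp add: ennreal_mult'' mult.assoc less_imp_le)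
    finally show "(\<integral>\<^sup>+E. ennreal (potential (Suc n) 0 E) \<partial>attach_edges m \<delta> (Suc n) m G)
      = ennreal (potential n 0 G) * ennreal (?f * initial_factor (Suc n))" .
  qed
  also have "\<dots> = ennreal ((\<Prod>u=1..n. initial_factor u) * (\<Prod>i=2..<n. \<Prod>j<m. step_factor i j)) * ennreal (?f * initial_factor (Suc n))"
    by (subst nn_integral_multc) (auto simp: step.IH)
  also have "\<dots> = ennreal ((\<Prod>u=1..Suc n. initial_factor u) * (\<Prod>i=2..<Suc n. \<Prod>j<m. step_factor i j))"
    using f initial_factor_pos[of "Suc n"] step.hyps
    by (subst ennreal_mult''[symmetric]) (auto simp: less_imp_le ac_simps prod.atLeastLessThan_Suc)
  finally show ?case .
qed

text \<open>At time \<open>t\<close> no edge is pending, so all rising factorials have order 0 and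
  the potential is the indicator of the event.\<close>

lemma prob_contains_edges:
  assumes t: "2 \<le> t" and M_le: "\<And>u v l. (u, v, l) \<in> M \<Longrightarrow> v \<le> t"
  shows "measure_pmf.prob (PA m \<delta> t) {E. M \<subseteq> labeled_edges m t E}
      = (\<Prod>u=1..t. initial_factor u) * (\<Prod>i=2..<t. \<Prod>j<m. step_factor i j)"
    (is "_ = ?R")
proof -
  have att: "(v, l) \<in> attached m t 0" if "(u, v, l) \<in> M" for u v l
    using M_le[OF that] edge_in_M[OF that] by (auto simp: attached_def)
  then have "{(v, l). (u, v, l) \<in> M \<and> (v, l) \<notin> attached m t 0} = {}" for u by auto
  then have "pending t 0 u = 0" for u unfolding pending_def by (simp only: card.empty)
  moreover have "consistent t 0 E \<longleftrightarrow> M \<subseteq> labeled_edges m t E" for E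
    unfolding consistent_def labeled_edges_def using att edge_in_M M_le by fastforce
  ultimately have "potential t 0 E = indicator {E. M \<subseteq> labeled_edges m t E} E" for E
    by (simp add: potential_def indicator_def)
  then have "ennreal ?R = emeasure (PA m \<delta> t) {E. M \<subseteq> labeled_edges m t E}"
    using nn_integral_PA[OF t] by (simp add: ennreal_indicator)
  moreover have "?R \<ge> 0" using initial_factor_pos step_factor_pos
    by (intro mult_nonneg_nonneg prod_nonneg) (auto simp: less_imp_le)
  ultimately show ?thesis
    by (simp add: measure_pmf.emeasure_eq_measure)
qed

section \<open>Order of magnitude of the product formula\<close>

lemma pending_alt: "pending n j u = card {(u', v, l) \<in> M. u' = u \<and> (v, l) \<notin> attached m n j}"
proof -
  have "bij_betw (\<lambda>(v, l). (u, v, l)) {(v, l). (u, v, l) \<in> M \<and> (v, l) \<notin> attached m n j}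
     {(u', v, l) \<in> M. u' = u \<and> (v, l) \<notin> attached m n j}"
    by (rule bij_betw_byWitness[where f' = snd]) auto
  then show ?thesis unfolding pending_def by (rule bij_betw_same_card)
qed

text \<open>The time \<open>f u\<close> may depend on the vertex because
  \<open>initial_factor u\<close> is read off when \<open>u\<close> enters. Every edge has one
  target and is counted at most once.\<close>

lemma pending_sum_le: "(\<Sum>u=1..t. pending (f u) j u) \<le> card M"
proof -
  have "(\<Sum>u=1..t. pending (f u) j u) = card (\<Union>u\<in>{1..t}. {(u', v, l) \<in> M. u' = u \<and> (v, l) \<notin> attached m (f u) j})"
    unfolding pending_alt
    by (rule card_UN_disjoint[symmetric]) (auto intro: finite_subset[OF _ finite_M])
  also have "\<dots> \<le> card M" by (rule card_mono[OF finite_M]) auto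
  finally show ?thesis .
qed

lemma pending_le: "pending n j u \<le> card M"
  unfolding pending_alt by (rule card_mono[OF finite_M]) auto

lemma pending_total_le: "pending_total n j \<le> card M"
  unfolding pending_total_def using pending_sum_le[where f = "\<lambda>_. n"] .

text \<open>Written as a sum over edges, the total can be exchanged with the sum over time, which
  reduces the logarithm of the product to one harmonic sum for each edge.\<close>

lemma pending_total_eq:
  "real (pending_total n j) = (\<Sum>(u, v, l)\<in>M. of_bool (u \<le> n \<and> (v, l) \<notin> attached m n j))"
proof -
  have "pending_total n j = card (\<Union>u\<in>{1..n}. {(u', v, l) \<in> M. u' = u \<and> (v, l) \<notin> attached m n j})"
    unfolding pending_alt pending_total_def
    by (rule card_UN_disjoint[symmetric]) (auto intro: finite_subset[OF _ finite_M])
  also have "(\<Union>u\<in>{1..n}. {(u', v, l) \<in> M. u' = u \<and> (v, l) \<notin> attached m n j})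
      = {e \<in> M. case e of (u, v, l) \<Rightarrow> u \<le> n \<and> (v, l) \<notin> attached m n j}"
    using edge_in_M by fastforce
  finally show ?thesis
    by (simp add: of_bool_def finite_M sum.If_cases Int_def case_prod_beta flip: sum.inter_filter)
qed

lemma initial_factor_bounds:
  "min 1 (real m + \<delta>) ^ card M \<le> (\<Prod>u=1..t. initial_factor u)"
  "(\<Prod>u=1..t. initial_factor u) \<le> (real m + \<delta> + real (card M) + 1) ^ card M"
proof -
  let ?p = "\<lambda>u. pending (max u 2) 0 u" and ?x = "real m + \<delta>"
  have x: "?x > 0" using \<delta>_gt by linarith
  have S: "(\<Sum>u=1..t. ?p u) \<le> card M" by (rule pending_sum_le)
  have "min 1 ?x ^ card M \<le> min 1 ?x ^ (\<Sum>u=1..t. ?p u)"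
    using S x by (intro power_decreasing) auto
  also have "\<dots> = (\<Prod>u=1..t. min 1 ?x ^ ?p u)" by (simp only: power_sum)
  also have "\<dots> \<le> (\<Prod>u=1..t. initial_factor u)"
    unfolding initial_factor_def using x pochhammer_bounds(1)[OF x order_refl] by (intro prod_mono) auto
  finally show "min 1 ?x ^ card M \<le> (\<Prod>u=1..t. initial_factor u)" .
  have "(\<Prod>u=1..t. initial_factor u) \<le> (\<Prod>u=1..t. (?x + real (card M) + 1) ^ ?p u)"
    using pochhammer_bounds(2)[OF x pending_le] initial_factor_pos
    by (intro prod_mono) (auto simp: less_imp_le initial_factor_def)
  also have "\<dots> = (?x + real (card M) + 1) ^ (\<Sum>u=1..t. ?p u)" by (simp only: power_sum)
  also have "\<dots> \<le> (?x + real (card M) + 1) ^ card M"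
    using S x by (intro power_increasing) auto
  finally show "(\<Prod>u=1..t. initial_factor u) \<le> (?x + real (card M) + 1) ^ card M" .
qed

text \<open>By \<open>functional_M\<close>, edges and prescribed slots correspond one to one. Edges
  of vertex 2 are placed deterministically and have no slot in the product, hence the factor 1 for
  \<open>v < 3\<close>.\<close>

lemma prod_slots:
  fixes f :: "nat \<Rightarrow> nat \<Rightarrow> real"
  assumes M_le: "\<And>u v l. (u, v, l) \<in> M \<Longrightarrow> v \<le> t"
  shows "(\<Prod>i=2..<t. \<Prod>j<m. if \<exists>u. (u, Suc i, Suc j) \<in> M then f i j else 1)
     = (\<Prod>(u, v, l)\<in>M. if v \<ge> 3 then f (v - 1) (l - 1) else 1)"
proof -
  let ?M = "{e \<in> M. fst (snd e) \<ge> 3}"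
  let ?h = "\<lambda>(u, v, l). (v - 1, l - 1 :: nat)"
  have inj: "inj_on ?h ?M"
  proof (rule inj_onI)
    fix e e' assume e: "e \<in> ?M" "e' \<in> ?M" "?h e = ?h e'"
    obtain u v l u' v' l' where ee: "e = (u, v, l)" "e' = (u', v', l')" by (metis prod_cases3)
    have "v = v'" "l = l'" using e edge_in_M[of u v l] edge_in_M[of u' v' l'] unfolding ee by auto
    then show "e = e'" using e functional_M unfolding ee by auto
  qed
  have img: "?h ` ?M = {(i, j) \<in> {2..<t} \<times> {..<m}. \<exists>u. (u, Suc i, Suc j) \<in> M}"
  proof (intro equalityI subsetI)
    fix p assume "p \<in> ?h ` ?M"
    then obtain u v l where e: "(u, v, l) \<in> M" "v \<ge> 3" "p = (v - 1, l - 1)" by auto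
    then show "p \<in> {(i, j) \<in> {2..<t} \<times> {..<m}. \<exists>u. (u, Suc i, Suc j) \<in> M}"
      using M_le[OF e(1)] edge_in_M[OF e(1)] by auto
  next
    fix p assume "p \<in> {(i, j) \<in> {2..<t} \<times> {..<m}. \<exists>u. (u, Suc i, Suc j) \<in> M}"
    then obtain u i j where p: "p = (i, j)" "(u, Suc i, Suc j) \<in> M" "i \<ge> 2" by auto
    then show "p \<in> ?h ` ?M" by (intro image_eqI[of _ _ "(u, Suc i, Suc j)"]) auto
  qed
  have "(\<Prod>i=2..<t. \<Prod>j<m. if \<exists>u. (u, Suc i, Suc j) \<in> M then f i j else 1)
     = (\<Prod>(i, j)\<in>{2..<t} \<times> {..<m}. if \<exists>u. (u, Suc i, Suc j) \<in> M then f i j else 1)"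
    by (rule prod.cartesian_product)
  also have "\<dots> = (\<Prod>p\<in>{p \<in> {2..<t} \<times> {..<m}. case p of (i, j) \<Rightarrow> \<exists>u. (u, Suc i, Suc j) \<in> M}. case p of (i, j) \<Rightarrow> f i j)"
    by (subst prod.inter_filter) (auto intro!: prod.cong)
  also have "{p \<in> {2..<t} \<times> {..<m}. case p of (i, j) \<Rightarrow> \<exists>u. (u, Suc i, Suc j) \<in> M} = ?h ` ?M"
    unfolding img by auto
  also have "(\<Prod>p\<in>?h ` ?M. case p of (i, j) \<Rightarrow> f i j) = (\<Prod>(u, v, l)\<in>?M. f (v - 1) (l - 1))"
    by (subst prod.reindex[OF inj]) (auto intro!: prod.cong)
  also have "\<dots> = (\<Prod>(u, v, l)\<in>M. if v \<ge> 3 then f (v - 1) (l - 1) else 1)"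
    by (subst prod.inter_filter[OF finite_M]) (auto intro!: prod.cong)
  finally show ?thesis .
qed

definition \<theta> :: real where "\<theta> = real m / (2 * real m + \<delta>)"

lemma a_pos: "2 * real m + \<delta> > 0" "\<theta> > 0"
  using \<delta>_gt m_pos unfolding \<theta>_def by (auto intro!: divide_pos_pos)

text \<open>The edge is pending from the arrival of \<open>u\<close> until its own slot is filled.
  At time \<open>i\<close> the \<open>m\<close> slots together contribute
  \<open>m / ((2 m + \<delta>) i) = \<theta> / i\<close>, so the sum is \<open>\<theta>\<close>
  times a harmonic sum from \<open>u\<close> to \<open>v\<close>.\<close>

lemma edge_sum_bound:
  assumes e: "(u, v, l) \<in> M" "v \<le> t"
  shows "\<bar>(\<Sum>i=2..<t. \<Sum>j<m. of_bool (u \<le> i \<and> (v, l) \<notin> attached m i j) / ((2 * real m + \<delta>) * real i))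
     - \<theta> * ln (real v / real u)\<bar> \<le> 2 * \<theta>"
proof -
  let ?a = "2 * real m + \<delta>"
  let ?b = "\<lambda>i j. of_bool (u \<le> i \<and> (v, l) \<notin> attached m i j) :: real"
  let ?s = "\<Sum>i=2..<t. \<Sum>j<m. ?b i j / (?a * real i)"
  have uv: "1 \<le> u" "u < v" "l \<in> {1..m}" using edge_in_M[OF e(1)] by auto
  have in_sum: "(\<Sum>j<m. c / (?a * real i)) = c * (\<theta> * (1 / real i))" for c i
    by (simp add: \<theta>_def)
  note H = harmonic_ln_bounds[of u v]
  have "?s \<le> (\<Sum>i=2..<t. \<Sum>j<m. of_bool (i \<in> {u..<v}) / (?a * real i))"
    using a_pos uv by (intro sum_mono divide_right_mono) (auto simp: attached_def)
  also have "\<dots> = (\<Sum>i=2..<t. of_bool (i \<in> {u..<v}) * (\<theta> * (1 / real i)))"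
    by (simp only: in_sum)
  also have "\<dots> = (\<Sum>i\<in>{2..<t} \<inter> {u..<v}. \<theta> * (1 / real i))"
    by (subst sum_of_bool_mult_eq) (auto intro!: sum.cong)
  also have "\<dots> \<le> (\<Sum>i=u..<v. \<theta> * (1 / real i))"
    using a_pos by (intro sum_mono2) auto
  also have "\<dots> \<le> \<theta> * (ln (real v / real u) + 1)"
    unfolding sum_distrib_left[symmetric] using a_pos H uv by (intro mult_left_mono) auto
  finally have up: "?s \<le> \<theta> * ln (real v / real u) + \<theta>" by (simp add: algebra_simps)
  \<comment> \<open>Two terms are given up: index 1 precedes the first random step, and at index
    \<open>v - 1\<close> only the slots before the edge's own still count it as pending. Each is at
    most 1.\<close>
  have "\<theta> * (ln (real v / real u) - 2) \<le> \<theta> * (\<Sum>i\<in>{2..<t} \<inter> {u..<v - 1}. 1 / real i)"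
  proof (intro mult_left_mono)
    have "ln (real v / real u) \<le> (\<Sum>i=u..<v. 1 / real i)" using H uv by simp
    also have "\<dots> \<le> (\<Sum>i\<in>({2..<t} \<inter> {u..<v - 1}) \<union> {1, v - 1}. 1 / real i)"
      using uv e by (intro sum_mono2) auto
    also have "\<dots> \<le> (\<Sum>i\<in>{2..<t} \<inter> {u..<v - 1}. 1 / real i) + (\<Sum>i\<in>{1, v - 1}. 1 / real i)"
      by (subst sum_Un) (auto intro!: sum_nonneg)
    also have "(\<Sum>i\<in>{1, v - 1}. 1 / real i) \<le> 2" using uv by (cases "v - 1 = 1") auto
    finally show "ln (real v / real u) - 2 \<le> (\<Sum>i\<in>{2..<t} \<inter> {u..<v - 1}. 1 / real i)" by linarith
  qed (use a_pos in auto)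
  also have "\<dots> = (\<Sum>i=2..<t. of_bool (i \<in> {u..<v - 1}) * (\<theta> * (1 / real i)))"
    unfolding sum_distrib_left by (subst sum_of_bool_mult_eq) (auto intro!: sum.cong)
  also have "\<dots> = (\<Sum>i=2..<t. \<Sum>j<m. of_bool (i \<in> {u..<v - 1}) / (?a * real i))"
    by (simp only: in_sum)
  also have "\<dots> \<le> ?s"
    using a_pos uv by (intro sum_mono divide_right_mono) (auto simp: attached_def)
  finally have "?s \<ge> \<theta> * ln (real v / real u) - 2 * \<theta>" by (simp add: algebra_simps)
  with up show ?thesis using a_pos by linarith
qed

text \<open>The first part collects the errors of order \<open>1 / i ^ 2\<close> over the
  \<open>m\<close> slots of each vertex, the last part the harmonic error of each edge. Only the
  cardinality of \<open>M\<close> enters, which makes the constants uniform.\<close>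

definition log_error :: real where
  "log_error = real m * ((real (card M))\<^sup>2 / (real m + \<delta>)\<^sup>2
      + real (card M) * (2 * real m) / ((real m + \<delta>) * (2 * real m + \<delta>))) + 2 * \<theta> * real (card M)"

text \<open>Two errors are quadratically small: that of \<open>ln (1 + x)\<close> against
  \<open>x\<close>, and that of replacing \<open>Z\<close> by \<open>(2 m + \<delta>) i\<close>,
  from which it differs by the bounded amount \<open>2 m - j\<close>.\<close>

lemma log_term_bound:
  assumes i: "2 \<le> i" and j: "j < m"
  shows "\<bar>ln (1 + real (pending_total i j) / total_weight i j)
      - real (pending_total i j) / ((2 * real m + \<delta>) * real i)\<bar>
    \<le> ((real (card M))\<^sup>2 / (real m + \<delta>)\<^sup>2
      + real (card M) * (2 * real m) / ((real m + \<delta>) * (2 * real m + \<delta>))) * (1 / (real i)\<^sup>2)"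
proof -
  let ?P = "real (pending_total i j)" and ?Z = "total_weight i j" and ?a = "2 * real m + \<delta>"
    and ?x = "real m + \<delta>" and ?L = "real (card M)"
  have x: "?x > 0" using \<delta>_gt by linarith
  have Z: "?Z \<ge> ?x * real i" "?Z > 0" using total_weight_ge[OF i] total_weight_pos[OF i] by auto
  have P: "0 \<le> ?P" "?P \<le> ?L" using pending_total_le by auto
  have xi: "?x * real i > 0" using x i by simp
  have PZ: "?P / ?Z \<le> ?L / (?x * real i)" using P Z xi by (intro frac_le) auto
  have "\<bar>ln (1 + ?P / ?Z) - ?P / ?Z\<bar> \<le> (?P / ?Z)\<^sup>2" using P Z by (intro ln_one_plus_bounds) auto
  also have "\<dots> \<le> (?L / (?x * real i))\<^sup>2" using PZ P Z by (intro power_mono) auto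
  finally have 1: "\<bar>ln (1 + ?P / ?Z) - ?P / ?Z\<bar> \<le> ?L\<^sup>2 / ?x\<^sup>2 * (1 / (real i)\<^sup>2)"
    by (simp add: power_divide power_mult_distrib)
  have "?P / ?Z - ?P / (?a * real i) = ?P * (?a * real i - ?Z) / (?Z * (?a * real i))"
  proof -
    have "p / z - p / b = p * (b - z) / (z * b)" if "z \<noteq> 0" "b \<noteq> 0" for p z b :: real
      using that by (simp add: field_simps)
    then show ?thesis using Z a_pos i by simp
  qed
  also have "?a * real i - ?Z = 2 * real m - real j" by (simp add: total_weight_def algebra_simps)
  finally have "\<bar>?P / ?Z - ?P / (?a * real i)\<bar> = ?P * (2 * real m - real j) / (?Z * (?a * real i))"
    using j P Z a_pos i by simp
  also have "\<dots> \<le> ?L * (2 * real m) / ((?x * real i) * (?a * real i))"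
    using j P Z a_pos i xi by (intro frac_le mult_mono) auto
  also have "\<dots> = ?L * (2 * real m) / (?x * ?a) * (1 / (real i)\<^sup>2)"
    by (simp add: power2_eq_square ac_simps)
  finally show ?thesis using 1 unfolding distrib_right by linarith
qed

lemma log_product_bound:
  assumes M_le: "\<And>u v l. (u, v, l) \<in> M \<Longrightarrow> v \<le> t"
  shows "\<bar>(\<Sum>i=2..<t. \<Sum>j<m. ln (1 + real (pending_total i j) / total_weight i j))
     - (\<Sum>(u, v, l)\<in>M. \<theta> * ln (real v / real u))\<bar> \<le> log_error"
proof -
  let ?a = "2 * real m + \<delta>"
  let ?A = "\<Sum>i=2..<t. \<Sum>j<m. ln (1 + real (pending_total i j) / total_weight i j)"
  let ?B = "\<Sum>i=2..<t. \<Sum>j<m. real (pending_total i j) / (?a * real i)"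
  let ?C = "\<Sum>(u, v, l)\<in>M. \<theta> * ln (real v / real u)"
  let ?K = "(real (card M))\<^sup>2 / (real m + \<delta>)\<^sup>2
      + real (card M) * (2 * real m) / ((real m + \<delta>) * ?a)"
  have x: "real m + \<delta> > 0" using \<delta>_gt by linarith
  have K: "?K \<ge> 0"
    using x a_pos(1) by (intro add_nonneg_nonneg[of "_ / _" "_ / _"] divide_nonneg_nonneg mult_nonneg_nonneg less_imp_le[OF x]) auto
  have "\<bar>?A - ?B\<bar> \<le> (\<Sum>i=2..<t. \<Sum>j<m. \<bar>ln (1 + real (pending_total i j) / total_weight i j) - real (pending_total i j) / (?a * real i)\<bar>)"
    unfolding sum_subtractf[symmetric] by (intro order_trans[OF sum_abs] sum_mono sum_abs)
  also have "\<dots> \<le> (\<Sum>i=2..<t. \<Sum>j<m. ?K * (1 / (real i)\<^sup>2))"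
    by (intro sum_mono log_term_bound) auto
  also have "\<dots> = real m * ?K * (\<Sum>i=2..<t. 1 / (real i)\<^sup>2)"
    by (simp add: sum_distrib_left)
  also have "\<dots> \<le> real m * ?K * 1" using K sum_inverse_squares_le by (intro mult_left_mono) auto
  finally have AB: "\<bar>?A - ?B\<bar> \<le> real m * ?K" by simp
  let ?D = "\<lambda>u v l. \<Sum>i=2..<t. \<Sum>j<m. of_bool (u \<le> i \<and> (v, l) \<notin> attached m i j) / (?a * real i)"
  have "?B = (\<Sum>i=2..<t. \<Sum>j<m. \<Sum>(u, v, l)\<in>M. of_bool (u \<le> i \<and> (v, l) \<notin> attached m i j) / (?a * real i))"
    unfolding pending_total_eq by (simp add: sum_divide_distrib case_prod_beta)
  also have "\<dots> = (\<Sum>i=2..<t. \<Sum>(u, v, l)\<in>M. \<Sum>j<m. of_bool (u \<le> i \<and> (v, l) \<notin> attached m i j) / (?a * real i))"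
    by (subst sum.swap) (simp add: case_prod_beta)
  also have "\<dots> = (\<Sum>(u, v, l)\<in>M. ?D u v l)"
    by (subst sum.swap) (simp add: case_prod_beta)
  finally have B: "?B = (\<Sum>(u, v, l)\<in>M. ?D u v l)" .
  have "\<bar>?B - ?C\<bar> \<le> (\<Sum>e\<in>M. \<bar>(case e of (u, v, l) \<Rightarrow> ?D u v l) - (case e of (u, v, l) \<Rightarrow> \<theta> * ln (real v / real u))\<bar>)"
    unfolding B sum_subtractf[symmetric] by (rule sum_abs)
  also have "\<dots> \<le> (\<Sum>e\<in>M. 2 * \<theta>)"
    using edge_sum_bound M_le by (intro sum_mono) auto
  finally have "\<bar>?B - ?C\<bar> \<le> 2 * \<theta> * real (card M)" by (simp add: ac_simps)
  with AB show ?thesis unfolding log_error_def by linarith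
qed

definition edge_weight :: real where
  "edge_weight = (\<Prod>(u, v, l)\<in>M. real u powr (- \<theta>) * real v powr (\<theta> - 1))"

text \<open>Chosen so that \<open>Z + P\<close> at an edge of vertex \<open>v\<close> is at most
  \<open>slot_const * v\<close>.\<close>

definition slot_const :: real where "slot_const = 3 * real m + \<bar>\<delta>\<bar> + real (card M)"

text \<open>The 2 inside the maximum serves edges of vertex 2, whose factor is
  \<open>1 = 2 / v\<close>; the other entry comes from \<open>v - 1 >= v / 2\<close>.\<close>

lemma slot_factor_bounds:
  assumes e: "(u, v, l) \<in> M"
  defines "f \<equiv> (if v \<ge> 3 then 1 / (total_weight (v - 1) (l - 1) + real (pending_total (v - 1) (l - 1))) else 1)"
  shows "(1 / slot_const) * (1 / real v) \<le> f" "f \<le> max 2 (2 / (real m + \<delta>)) * (1 / real v)"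
proof -
  have uv: "1 \<le> u" "u < v" "l \<in> {1..m}" using edge_in_M[OF e(1)] by auto
  have D: "slot_const \<ge> 1" using m_pos by (simp add: slot_const_def)
  have x: "real m + \<delta> > 0" using \<delta>_gt by linarith
  have "(1 / slot_const) * (1 / real v) \<le> f \<and> f \<le> max 2 (2 / (real m + \<delta>)) * (1 / real v)"
  proof (cases "v \<ge> 3")
    case False
    then have "v = 2" using uv by simp
    moreover have "1 / (slot_const * 2) \<le> 1" using D by simp
    ultimately show ?thesis using False by (simp add: f_def)
  next
    case True
    let ?Z = "total_weight (v - 1) (l - 1)" and ?P = "real (pending_total (v - 1) (l - 1))"
    have P: "0 \<le> ?P" "?P \<le> real (card M)" using pending_total_le by auto
    have Z: "?Z \<ge> (real m + \<delta>) * real (v - 1)" using True by (intro total_weight_ge) auto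
    have "(real m + \<delta>) * (real v / 2) \<le> (real m + \<delta>) * real (v - 1)"
      using True x by (intro mult_left_mono) (auto simp: of_nat_diff)
    then have lo: "(real m + \<delta>) * (real v / 2) \<le> ?Z + ?P" using Z P by linarith
    have "2 * real m * (real (v - 1) - 1) \<le> 2 * real m * real v"
      using True by (intro mult_left_mono) auto
    moreover have "real (l - 1) \<le> real m * real v"
      using uv True mult_mono[of "real (l - 1)" "real m" 1 "real v"] by simp
    moreover have "real (v - 1) * \<delta> \<le> real (v - 1) * \<bar>\<delta>\<bar>" by (intro mult_left_mono) auto
    moreover have "real (v - 1) * \<bar>\<delta>\<bar> \<le> real v * \<bar>\<delta>\<bar>" by (intro mult_right_mono) auto
    moreover have "real (card M) \<le> real (card M) * real v"
      using True by (simp add: mult_le_cancel_left1)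
    ultimately have "?Z + ?P \<le> 2 * real m * real v + real m * real v + real v * \<bar>\<delta>\<bar> + real (card M) * real v"
      using P unfolding total_weight_def by linarith
    also have "\<dots> = slot_const * real v" by (simp add: slot_const_def algebra_simps)
    finally have hi: "?Z + ?P \<le> slot_const * real v" .
    have pos: "(real m + \<delta>) * (real v / 2) > 0" using x True by simp
    have ZP: "?Z + ?P > 0" "real v > 0" "slot_const > 0" using lo pos D True by linarith+
    have f: "f = 1 / (?Z + ?P)" using True by (simp add: f_def)
    have "1 / (slot_const * real v) \<le> f"
      unfolding f by (rule divide_left_mono[OF hi]) (use ZP in auto)
    moreover have "f \<le> 1 / ((real m + \<delta>) * (real v / 2))"
      unfolding f by (rule divide_left_mono[OF lo]) (use ZP x in auto)
    moreover have "1 / ((real m + \<delta>) * (real v / 2)) = 2 / (real m + \<delta>) * (1 / real v)" by simp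
    moreover have "2 / (real m + \<delta>) * (1 / real v) \<le> max 2 (2 / (real m + \<delta>)) * (1 / real v)"
      by (intro mult_right_mono) auto
    ultimately show ?thesis by simp
  qed
  then show "(1 / slot_const) * (1 / real v) \<le> f" "f \<le> max 2 (2 / (real m + \<delta>)) * (1 / real v)" by auto
qed

lemma prob_bounds:
  assumes t: "2 \<le> t" and M_le: "\<And>u v l. (u, v, l) \<in> M \<Longrightarrow> v \<le> t"
  defines "p \<equiv> measure_pmf.prob (PA m \<delta> t) {E. M \<subseteq> labeled_edges m t E}"
  shows "min 1 (real m + \<delta>) ^ card M * exp (- log_error) * (1 / slot_const) ^ card M * edge_weight \<le> p"
    and "p \<le> (real m + \<delta> + real (card M) + 1) ^ card M * exp log_error * max 2 (2 / (real m + \<delta>)) ^ card M * edge_weight"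
proof -
  let ?f = "\<lambda>i j. 1 / (total_weight i j + real (pending_total i j))"
  let ?A = "\<Prod>i=2..<t. \<Prod>j<m. 1 + real (pending_total i j) / total_weight i j"
  let ?S = "\<Prod>(u, v, l)\<in>M. if v \<ge> 3 then ?f (v - 1) (l - 1) else 1"
  let ?R = "\<Prod>(u, v, l)\<in>M. real v powr \<theta> * real u powr (-\<theta>)"
  let ?V = "\<Prod>(u, v, l)\<in>M. 1 / real v"
  let ?I = "\<Prod>u=1..t. initial_factor u"
  have x: "real m + \<delta> > 0" using \<delta>_gt by linarith
  have p_eq: "p = ?I * (?A * ?S)"
  proof -
    have "p = ?I * (\<Prod>i=2..<t. \<Prod>j<m. step_factor i j)"
      unfolding p_def by (rule prob_contains_edges[OF t]) (erule M_le)
    moreover have "(\<Prod>i=2..<t. \<Prod>j<m. if \<exists>u. (u, Suc i, Suc j) \<in> M then ?f i j else 1) = ?S"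
      by (rule prod_slots) (erule M_le)
    ultimately show ?thesis unfolding step_factor_def prod.distrib by simp
  qed
  have A_exp: "?A = exp (\<Sum>i=2..<t. \<Sum>j<m. ln (1 + real (pending_total i j) / total_weight i j))"
    using total_weight_pos by (auto simp: exp_sum add_pos_nonneg less_imp_le intro!: prod.cong)
  have R: "?R = exp (\<Sum>(u, v, l)\<in>M. \<theta> * ln (real v / real u))"
    unfolding exp_sum[OF finite_M]
  proof (intro prod.cong refl)
    fix e assume e: "e \<in> M"
    obtain u v l where ee: "e = (u, v, l)" by (metis prod_cases3)
    have "1 \<le> u" "u < v" using edge_in_M e unfolding ee by auto
    then show "(case e of (u, v, l) \<Rightarrow> real v powr \<theta> * real u powr (-\<theta>)) = exp (case e of (u, v, l) \<Rightarrow> \<theta> * ln (real v / real u))"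
      by (simp add: ee powr_def ln_div exp_add[symmetric] algebra_simps)
  qed
  have W: "edge_weight = ?R * ?V"
    unfolding edge_weight_def prod.distrib[symmetric]
    using edge_in_M by (intro prod.cong refl) (auto simp: powr_diff dest!: edge_in_M)
  have err: "\<bar>(\<Sum>i=2..<t. \<Sum>j<m. ln (1 + real (pending_total i j) / total_weight i j))
     - (\<Sum>(u, v, l)\<in>M. \<theta> * ln (real v / real u))\<bar> \<le> log_error" by (rule log_product_bound) (erule M_le)
  have Alo: "exp (- log_error) * ?R \<le> ?A" and Ahi: "?A \<le> exp log_error * ?R"
    using err unfolding A_exp R exp_add[symmetric] by auto
  have Rpos: "?R > 0" unfolding R by simp
  have Vpos: "?V \<ge> 0" by (intro prod_nonneg) auto
  have "(1 / slot_const) ^ card M * ?V = (\<Prod>e\<in>M. (1 / slot_const) * (case e of (u, v, l) \<Rightarrow> 1 / real v))"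
    by (simp only: prod.distrib prod_constant)
  also have "\<dots> \<le> ?S"
  proof (intro prod_mono conjI)
    fix e assume e: "e \<in> M"
    obtain u v l where ee: "e = (u, v, l)" by (metis prod_cases3)
    show "0 \<le> (1 / slot_const) * (case e of (u, v, l) \<Rightarrow> 1 / real v)" by (simp add: ee slot_const_def)
    show "(1 / slot_const) * (case e of (u, v, l) \<Rightarrow> 1 / real v)
        \<le> (case e of (u, v, l) \<Rightarrow> if v \<ge> 3 then ?f (v - 1) (l - 1) else 1)"
      using slot_factor_bounds(1)[of u v l] e unfolding ee by simp
  qed
  finally have Slo: "(1 / slot_const) ^ card M * ?V \<le> ?S" .
  have "?S \<le> (\<Prod>e\<in>M. max 2 (2 / (real m + \<delta>)) * (case e of (u, v, l) \<Rightarrow> 1 / real v))"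
  proof (intro prod_mono conjI)
    fix e assume e: "e \<in> M"
    obtain u v l where ee: "e = (u, v, l)" by (metis prod_cases3)
    have "0 \<le> (1 / slot_const) * (1 / real v)" by (simp add: slot_const_def)
    then show "0 \<le> (case e of (u, v, l) \<Rightarrow> if v \<ge> 3 then ?f (v - 1) (l - 1) else 1)"
      using order_trans[OF _ slot_factor_bounds(1)[of u v l]] e unfolding ee prod.case by blast
    show "(case e of (u, v, l) \<Rightarrow> if v \<ge> 3 then ?f (v - 1) (l - 1) else 1) \<le> max 2 (2 / (real m + \<delta>)) * (case e of (u, v, l) \<Rightarrow> 1 / real v)"
      using slot_factor_bounds(2)[of u v l] e unfolding ee by simp
  qed
  also have "\<dots> = max 2 (2 / (real m + \<delta>)) ^ card M * ?V"
    by (simp only: prod.distrib prod_constant)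
  finally have Shi: "?S \<le> max 2 (2 / (real m + \<delta>)) ^ card M * ?V" .
  have sc: "slot_const > 0" using m_pos by (simp add: slot_const_def)
  have S0: "?S \<ge> 0" using Slo Vpos sc by (smt (verit) divide_nonneg_nonneg mult_nonneg_nonneg zero_le_power)
  have A0: "?A \<ge> 0" unfolding A_exp by simp
  have I0: "?I \<ge> 0" using initial_factor_pos by (intro prod_nonneg) (auto simp: less_imp_le)
  have "min 1 (real m + \<delta>) ^ card M * ((exp (- log_error) * ?R) * ((1 / slot_const) ^ card M * ?V)) \<le> ?I * (?A * ?S)"
    using initial_factor_bounds(1) Alo Slo Rpos Vpos sc x A0 I0
    by (intro mult_mono mult_nonneg_nonneg) auto
  then show "min 1 (real m + \<delta>) ^ card M * exp (- log_error) * (1 / slot_const) ^ card M * edge_weight \<le> p"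
    unfolding p_eq W by (simp only: ac_simps)
  have "?I * (?A * ?S) \<le> (real m + \<delta> + real (card M) + 1) ^ card M * ((exp log_error * ?R) * (max 2 (2 / (real m + \<delta>)) ^ card M * ?V))"
    using initial_factor_bounds(2) Ahi Shi Rpos Vpos x A0 I0 S0
    by (intro mult_mono mult_nonneg_nonneg) auto
  then show "p \<le> (real m + \<delta> + real (card M) + 1) ^ card M * exp log_error * max 2 (2 / (real m + \<delta>)) ^ card M * edge_weight"
    unfolding p_eq W by (simp only: ac_simps)
qed

end

text \<open>The constants are restated in terms of the number \<open>N\<close> of edges, so that
  they can be chosen before the edge set and the time.\<close>

lemma edge_probability_bounds:
  fixes m N :: nat and \<delta> :: real
  assumes "1 \<le> m" "\<delta> > - real m"
  shows "\<exists>c C. 0 < c \<and> 0 < C \<and> (\<forall>M t. PA_edges m \<delta> M \<longrightarrow> card M = N \<longrightarrow> 2 \<le> t \<longrightarrow>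
     (\<forall>(u, v, l)\<in>M. v \<le> t) \<longrightarrow>
     c * PA_edges.edge_weight m \<delta> M \<le> measure_pmf.prob (PA m \<delta> t) {E. M \<subseteq> labeled_edges m t E} \<and>
     measure_pmf.prob (PA m \<delta> t) {E. M \<subseteq> labeled_edges m t E} \<le> C * PA_edges.edge_weight m \<delta> M)"
proof -
  define th where "th = real m / (2 * real m + \<delta>)"
  define err where "err = real m * ((real N)\<^sup>2 / (real m + \<delta>)\<^sup>2
      + real N * (2 * real m) / ((real m + \<delta>) * (2 * real m + \<delta>))) + 2 * th * real N"
  define sc where "sc = 3 * real m + \<bar>\<delta>\<bar> + real N"
  define c where "c = min 1 (real m + \<delta>) ^ N * exp (- err) * (1 / sc) ^ N"
  define C where "C = (real m + \<delta> + real N + 1) ^ N * exp err * max 2 (2 / (real m + \<delta>)) ^ N"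
  have "sc > 0" using assms by (simp add: sc_def)
  moreover have "real m + \<delta> > 0" using assms by linarith
  ultimately have "c > 0" "C > 0" unfolding c_def C_def by (auto intro!: mult_pos_pos zero_less_power simp: max_def)
  moreover have "c * PA_edges.edge_weight m \<delta> M \<le> measure_pmf.prob (PA m \<delta> t) {E. M \<subseteq> labeled_edges m t E} \<and>
     measure_pmf.prob (PA m \<delta> t) {E. M \<subseteq> labeled_edges m t E} \<le> C * PA_edges.edge_weight m \<delta> M"
    if M: "PA_edges m \<delta> M" "card M = N" "2 \<le> t" "\<forall>(u, v, l)\<in>M. v \<le> t" for M t
  proof -
    interpret PA_edges m \<delta> M by (rule M(1))
    have "err = log_error" "sc = slot_const"
      by (simp_all add: err_def log_error_def sc_def slot_const_def th_def \<theta>_def M(2))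
    moreover have le: "v \<le> t" if "(u, v, l) \<in> M" for u v l using M(4) that by blast
    ultimately show ?thesis unfolding c_def C_def M(2)[symmetric]
      by (auto intro!: prob_bounds[OF M(3)] elim!: le)
  qed
  ultimately show ?thesis by blast
qed

section \<open>Counting copies\<close>

definition possible_edges :: "nat \<Rightarrow> nat \<Rightarrow> (nat \<times> nat \<times> nat) set" where
  "possible_edges m t = {(u, v, j). 1 \<le> u \<and> u < v \<and> v \<le> t \<and> j \<in> {1..m}}"

definition ith :: "nat set \<Rightarrow> nat \<Rightarrow> nat" where
  "ith S a = sorted_list_of_set S ! (a - 1)"

text \<open>
  Distinct elements of such an edge set may agree in the last two coordinates; no realisation
  of the process then contains the set.
\<close>
definition realizations ::
  "nat \<Rightarrow> nat \<Rightarrow> nat \<Rightarrow> (nat \<Rightarrow> nat \<Rightarrow> nat) \<Rightarrow> nat set \<Rightarrow> (nat \<times> nat \<times> nat) set set" where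
  "realizations m t k c S = {M. M \<subseteq> possible_edges m t \<and> (\<forall>(u, v, j)\<in>M. u \<in> S \<and> v \<in> S) \<and>
     (\<forall>a\<in>{1..k}. \<forall>b\<in>{1..k}. card {(u, v, j) \<in> M. v = ith S a \<and> u = ith S b} = c a b)}"

definition arc_count :: "('a, 'b) pre_digraph \<Rightarrow> ('a \<Rightarrow> nat) \<Rightarrow> nat \<Rightarrow> nat \<Rightarrow> nat" where
  "arc_count H \<pi> a b = card {e \<in> arcs H. tail H e = vertex_at H \<pi> a \<and> head H e = vertex_at H \<pi> b}"

lemma finite_possible_edges: "finite (possible_edges m t)"
  by (rule finite_subset[of _ "{1..t} \<times> {1..t} \<times> {1..m}"]) (auto simp: possible_edges_def)

lemma finite_realizations: "finite (realizations m t k c S)"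
  by (rule finite_subset[of _ "Pow (possible_edges m t)"])
    (auto simp: realizations_def finite_possible_edges)

lemma ith_bij:
  assumes "finite S" "card S = k"
  shows "bij_betw (ith S) {1..k} S"
proof -
  have "bij_betw ((!) (sorted_list_of_set S)) {..<length (sorted_list_of_set S)} (set (sorted_list_of_set S))"
    by (rule bij_betw_nth) auto
  then have "bij_betw ((!) (sorted_list_of_set S)) {..<k} S" using assms by simp
  moreover have "bij_betw (\<lambda>a. a - 1) {1..k} {..<k}"
    by (rule bij_betw_byWitness[where f' = Suc]) auto
  ultimately have "bij_betw ((!) (sorted_list_of_set S) \<circ> (\<lambda>a. a - 1)) {1..k} S"
    by (rule bij_betw_trans[rotated])
  then show ?thesis by (simp add: comp_def ith_def[abs_def])
qed

lemma ith_strict_mono: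
  assumes "finite S" "card S = k" "1 \<le> a" "a < b" "b \<le> k"
  shows "ith S a < ith S b"
  unfolding ith_def
  by (rule sorted_wrt_nth_less[OF strict_sorted_list_of_set]) (use assms in auto)

text \<open>A copy is a vertex set together with an edge set from a deterministic finite family,
  subject to the event that the edges are present; linearity of expectation then applies.\<close>

lemma expected_N_eq:
  "expected_N m \<delta> t H \<pi> = (\<Sum>S | S \<subseteq> {1..t} \<and> card S = card (verts H).
     \<Sum>M\<in>realizations m t (card (verts H)) (arc_count H \<pi>) S.
       measure_pmf.prob (PA m \<delta> t) {E. M \<subseteq> labeled_edges m t E})"
proof -
  let ?k = "card (verts H)"
  let ?X = "{S. S \<subseteq> {1..t} \<and> card S = ?k}"
  let ?R = "realizations m t ?k (arc_count H \<pi>)"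
  have finX: "finite ?X" by (rule finite_subset[of _ "Pow {1..t}"]) auto
  have le: "labeled_edges m t E \<subseteq> possible_edges m t" for E
    by (auto simp: labeled_edges_def possible_edges_def)
  have "copies m t H \<pi> E = (SIGMA S:?X. {M \<in> ?R S. M \<subseteq> labeled_edges m t E})" for E
    unfolding copies_def realizations_def arc_count_def ith_def using le[of E] by auto
  then have "real (num_copies m t H \<pi> E) = (\<Sum>S\<in>?X. \<Sum>M\<in>?R S. indicator {E. M \<subseteq> labeled_edges m t E} E)" for E
    using finX finite_realizations
    by (simp add: num_copies_def card_SigmaI indicator_def sum.If_cases Int_def)
  then have "expected_N m \<delta> t H \<pi> =
     measure_pmf.expectation (PA m \<delta> t) (\<lambda>E. \<Sum>S\<in>?X. \<Sum>M\<in>?R S. indicator {E. M \<subseteq> labeled_edges m t E} E)"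
    by (simp add: expected_N_def)
  also have "\<dots> = (\<Sum>S\<in>?X. \<Sum>M\<in>?R S. measure_pmf.expectation (PA m \<delta> t) (indicator {E. M \<subseteq> labeled_edges m t E}))"
  proof -
    have "integrable (measure_pmf (PA m \<delta> t)) (indicator A :: targets \<Rightarrow> real)" for A
      by (rule integrable_real_indicator) (auto simp: measure_pmf.emeasure_eq_measure)
    then show ?thesis
      by (simp only: Bochner_Integration.integral_sum Bochner_Integration.integrable_sum)
  qed
  finally show ?thesis by simp
qed

text \<open>Edges are grouped by their pair of end points, and the pairs are then indexed by
  positions in \<open>S\<close>.\<close>

lemma realization_prod:
  fixes F :: "nat \<Rightarrow> nat \<Rightarrow> real"
  assumes S: "finite S" "card S = k" and M: "M \<in> realizations m t k c S"
  shows "(\<Prod>(u, v, j)\<in>M. F v u) = (\<Prod>a=1..k. \<Prod>b=1..k. F (ith S a) (ith S b) ^ c a b)"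
proof -
  have finM: "finite M" using M finite_possible_edges finite_subset by (auto simp: realizations_def)
  have MS: "u \<in> S \<and> v \<in> S" if "(u, v, j) \<in> M" for u v j using M that by (auto simp: realizations_def)
  have "(\<Prod>(u, v, j)\<in>M. F v u) = (\<Prod>p\<in>S \<times> S. \<Prod>e\<in>{e \<in> M. (\<lambda>(u, v, j). (v, u)) e = p}. case e of (u, v, j) \<Rightarrow> F v u)"
    by (rule prod.group[symmetric]) (use finM S MS in auto)
  also have "\<dots> = (\<Prod>p\<in>S \<times> S. case p of (v, u) \<Rightarrow> F v u ^ card {(u', v', j) \<in> M. v' = v \<and> u' = u})"
  proof (intro prod.cong refl)
    fix p assume "p \<in> S \<times> S"
    obtain v u where p: "p = (v, u)" by fastforce
    have "(\<Prod>e\<in>{e \<in> M. (\<lambda>(u, v, j). (v, u)) e = p}. case e of (u, v, j) \<Rightarrow> F v u)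
        = (\<Prod>e\<in>{e \<in> M. (\<lambda>(u, v, j). (v, u)) e = p}. F v u)"
      by (intro prod.cong) (auto simp: p)
    also have "\<dots> = F v u ^ card {e \<in> M. (\<lambda>(u, v, j). (v, u)) e = p}" by simp
    also have "card {e \<in> M. (\<lambda>(u, v, j). (v, u)) e = p} = card {(u', v', j) \<in> M. v' = v \<and> u' = u}"
      by (rule arg_cong[where f = card]) (auto simp: p)
    finally show "(\<Prod>e\<in>{e \<in> M. (\<lambda>(u, v, j). (v, u)) e = p}. case e of (u, v, j) \<Rightarrow> F v u) =
        (case p of (v, u) \<Rightarrow> F v u ^ card {(u', v', j) \<in> M. v' = v \<and> u' = u})" unfolding p prod.case .
  qed
  also have "\<dots> = (\<Prod>v\<in>S. \<Prod>u\<in>S. F v u ^ card {(u', v', j) \<in> M. v' = v \<and> u' = u})"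
    by (rule prod.cartesian_product[symmetric])
  also have "\<dots> = (\<Prod>a\<in>{1..k}. \<Prod>u\<in>S. F (ith S a) u ^ card {(u', v', j) \<in> M. v' = ith S a \<and> u' = u})"
    by (rule prod.reindex_bij_betw[OF ith_bij[OF S], symmetric])
  also have "\<dots> = (\<Prod>a\<in>{1..k}. \<Prod>b\<in>{1..k}. F (ith S a) (ith S b) ^ card {(u', v', j) \<in> M. v' = ith S a \<and> u' = ith S b})"
    by (intro prod.cong refl prod.reindex_bij_betw[OF ith_bij[OF S], symmetric])
  also have "\<dots> = (\<Prod>a=1..k. \<Prod>b=1..k. F (ith S a) (ith S b) ^ c a b)"
    using M by (intro prod.cong refl) (auto simp: realizations_def)
  finally show ?thesis .
qed

lemma realization_card:
  assumes "finite S" "card S = k" "M \<in> realizations m t k c S"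
  shows "card M = (\<Sum>a=1..k. \<Sum>b=1..k. c a b)"
proof -
  \<comment> \<open>The product formula for the constant function 2 counts the edges in the
    exponent.\<close>
  have "(2::real) ^ card M = (\<Prod>(u, v, j)\<in>M. 2)" by (simp add: case_prod_beta)
  also have "\<dots> = 2 ^ (\<Sum>a=1..k. \<Sum>b=1..k. c a b)"
    by (subst realization_prod[OF assms]) (simp add: power_sum)
  finally show ?thesis by simp
qed

text \<open>Exponents are collected at each vertex: an edge contributes \<open>- \<theta>\<close> at
  its head and \<open>\<theta> - 1\<close> at its tail. Swapping the double product of the head
  factors brings both kinds to the same vertex.\<close>

lemma realization_weight:
  assumes S: "finite S" "card S = k" "0 \<notin> S" and M: "M \<in> realizations m t k c S" and PA: "PA_edges m \<delta> M"
  shows "PA_edges.edge_weight m \<delta> M = (\<Prod>a=1..k. real (ith S a) powr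
     (- (real m / (2 * real m + \<delta>)) * real (\<Sum>b=1..k. c b a) + (real m / (2 * real m + \<delta>) - 1) * real (\<Sum>b=1..k. c a b)))"
proof -
  interpret PA_edges m \<delta> M by (rule PA)
  have pos: "ith S a > 0" if "a \<in> {1..k}" for a
    using bij_betwE[OF ith_bij[OF S(1,2)]] that S(3) by (metis gr0I)
  have "edge_weight = (\<Prod>(u, v, j)\<in>M. (\<lambda>v u. real u powr (- \<theta>) * real v powr (\<theta> - 1)) v u)"
    by (simp add: edge_weight_def)
  also have "\<dots> = (\<Prod>a=1..k. \<Prod>b=1..k. (real (ith S b) powr (- \<theta>) * real (ith S a) powr (\<theta> - 1)) ^ c a b)"
    by (rule realization_prod[OF S(1,2) M])
  also have "\<dots> = (\<Prod>a=1..k. \<Prod>b=1..k. real (ith S b) powr (- \<theta> * c a b)) *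
      (\<Prod>a=1..k. \<Prod>b=1..k. real (ith S a) powr ((\<theta> - 1) * c a b))"
    unfolding prod.distrib[symmetric]
  proof (intro prod.cong refl)
    fix a b assume "a \<in> {1..k}" "b \<in> {1..k}"
    then have "real (ith S a) > 0" "real (ith S b) > 0" using pos by simp_all
    then show "(real (ith S b) powr (- \<theta>) * real (ith S a) powr (\<theta> - 1)) ^ c a b =
       real (ith S b) powr (- \<theta> * c a b) * real (ith S a) powr ((\<theta> - 1) * c a b)"
      by (simp add: power_mult_distrib powr_power mult.commute)
  qed
  also have "(\<Prod>a=1..k. \<Prod>b=1..k. real (ith S b) powr (- \<theta> * c a b)) =
      (\<Prod>a=1..k. \<Prod>b=1..k. real (ith S a) powr (- \<theta> * c b a))"
    by (rule prod.swap)
  also have "\<dots> * (\<Prod>a=1..k. \<Prod>b=1..k. real (ith S a) powr ((\<theta> - 1) * c a b)) =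
      (\<Prod>a=1..k. real (ith S a) powr (- \<theta> * real (\<Sum>b=1..k. c b a) + (\<theta> - 1) * real (\<Sum>b=1..k. c a b)))"
    unfolding prod.distrib[symmetric]
  proof (intro prod.cong refl)
    fix a assume a: "a \<in> {1..k}"
    have "(\<Prod>b=1..k. real (ith S a) powr (f b)) = real (ith S a) powr (\<Sum>b=1..k. f b)" for f :: "nat \<Rightarrow> real"
      using pos[OF a] by (simp add: powr_sum)
    then show "(\<Prod>b=1..k. real (ith S a) powr (- \<theta> * c b a) * real (ith S a) powr ((\<theta> - 1) * c a b)) =
      real (ith S a) powr (- \<theta> * real (\<Sum>b=1..k. c b a) + (\<theta> - 1) * real (\<Sum>b=1..k. c a b))"
      by (simp only: prod.distrib powr_add sum_distrib_left of_nat_sum)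
  qed
  finally show ?thesis by (simp only: \<theta>_def)
qed

text \<open>The bound depends neither on \<open>t\<close> nor on the position of \<open>S\<close>,
  so summing over all realisations costs only a constant.\<close>

lemma card_realizations_le:
  assumes "finite S" "card S = k"
  shows "card (realizations m t k c S) \<le> 2 ^ (k * k * m)"
proof -
  have "realizations m t k c S \<subseteq> Pow (S \<times> S \<times> {1..m})"
    by (force simp: realizations_def possible_edges_def)
  then have "card (realizations m t k c S) \<le> card (Pow (S \<times> S \<times> {1..m}))"
    using assms by (intro card_mono) auto
  also have "\<dots> = 2 ^ (k * k * m)"
    using assms by (simp add: card_Pow card_cartesian_product mult.assoc)
  finally show ?thesis .
qed

text \<open>Attainability is what makes the lower bound possible: its order condition directs the
  edges from newer to older vertices, and its degree condition supplies the labels.\<close>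

lemma realization_exists:
  fixes H :: "('a, 'b) pre_digraph"
  assumes H: "fin_digraph H" "arrival_order H \<pi>" "attainable m H \<pi>"
    and S: "S \<subseteq> {1..t}" "card S = card (verts H)" and \<delta>: "1 \<le> m" "\<delta> > - real m"
  shows "\<exists>M\<in>realizations m t (card (verts H)) (arc_count H \<pi>) S. PA_edges m \<delta> M"
proof -
  interpret fin_digraph H by (rule H(1))
  let ?k = "card (verts H)"
  have finS: "finite S" using S(1) finite_subset by blast
  have bij: "bij_betw \<pi> (verts H) {1..?k}" using H(2) by (simp add: arrival_order_def)
  have \<pi>_inj: "\<pi> x = \<pi> y \<longleftrightarrow> x = y" if "x \<in> verts H" "y \<in> verts H" for x y
    using inj_on_eq_iff[OF bij_betw_imp_inj_on[OF bij] that] .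
  have \<pi>_range: "\<pi> x \<in> {1..?k}" if "x \<in> verts H" for x using bij that bij_betwE by blast
  have va: "vertex_at H \<pi> a \<in> verts H" "\<pi> (vertex_at H \<pi> a) = a" if "a \<in> {1..?k}" for a
    using bij that unfolding vertex_at_def bij_betw_def by (auto intro: inv_into_into f_inv_into_f)
  have sbij: "bij_betw (ith S) {1..?k} S" by (rule ith_bij[OF finS S(2)])
  have s_inj: "ith S a = ith S b \<longleftrightarrow> a = b" if "a \<in> {1..?k}" "b \<in> {1..?k}" for a b
    using inj_on_eq_iff[OF bij_betw_imp_inj_on[OF sbij] that] .
  have s_in: "ith S a \<in> S" if "a \<in> {1..?k}" for a using sbij that bij_betwE by blast
  \<comment> \<open>At most \<open>m\<close> arcs leave a vertex, so they can be given distinct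
    labels; this later yields functionality of \<open>M\<close>.\<close>
  have "\<exists>f. f ` out_arcs H x \<subseteq> {1..m} \<and> inj_on f (out_arcs H x)" if "x \<in> verts H" for x
    using that H(3) by (intro card_le_inj) (auto simp: attainable_def out_degree_def)
  then obtain lab where lab: "\<And>x. x \<in> verts H \<Longrightarrow> lab x ` out_arcs H x \<subseteq> {1..m}"
    "\<And>x. x \<in> verts H \<Longrightarrow> inj_on (lab x) (out_arcs H x)" by metis
  let ?s = "\<lambda>x. ith S (\<pi> x)"
  let ?g = "\<lambda>e. (?s (head H e), ?s (tail H e), lab (tail H e) e)"
  define M where "M = ?g ` arcs H"
  have s_eq: "?s x = ?s y \<longleftrightarrow> x = y" if "x \<in> verts H" "y \<in> verts H" for x y
    using s_inj \<pi>_range \<pi>_inj that by simp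
  have tail_lab: "e = e'" if "e \<in> arcs H" "e' \<in> arcs H" "?s (tail H e) = ?s (tail H e')"
    "lab (tail H e) e = lab (tail H e') e'" for e e'
  proof -
    have "tail H e = tail H e'" using s_eq that by auto
    then show ?thesis using lab(2)[of "tail H e"] that by (auto simp: inj_on_def)
  qed
  have edge: "1 \<le> ?s (head H e) \<and> ?s (head H e) < ?s (tail H e) \<and> ?s (tail H e) \<le> t \<and>
     lab (tail H e) e \<in> {1..m} \<and> ?s (head H e) \<in> S \<and> ?s (tail H e) \<in> S" if e: "e \<in> arcs H" for e
  proof -
    have v: "head H e \<in> verts H" "tail H e \<in> verts H" using e by auto
    have "\<pi> (head H e) < \<pi> (tail H e)" using H(3) e by (auto simp: attainable_def)
    then have "?s (head H e) < ?s (tail H e)"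
      using \<pi>_range[OF v(1)] \<pi>_range[OF v(2)] by (intro ith_strict_mono[OF finS S(2)]) auto
    moreover have "?s (head H e) \<in> S" "?s (tail H e) \<in> S" using s_in \<pi>_range v by auto
    moreover have "lab (tail H e) e \<in> {1..m}" proof -
      have "e \<in> out_arcs H (tail H e)" using e by simp
      then show ?thesis using lab(1)[OF v(2)] by blast
    qed
    ultimately show ?thesis using S(1) by auto
  qed
  have "M \<in> realizations m t ?k (arc_count H \<pi>) S"
    unfolding realizations_def
  proof (intro CollectI conjI ballI)
    show "M \<subseteq> possible_edges m t" using edge by (auto simp: M_def possible_edges_def)
    show "case e of (u, v, j) \<Rightarrow> u \<in> S \<and> v \<in> S" if "e \<in> M" for e using that edge by (auto simp: M_def)
    fix a b assume ab: "a \<in> {1..?k}" "b \<in> {1..?k}"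
    have conv: "?s x = ith S a \<longleftrightarrow> x = vertex_at H \<pi> a" if "x \<in> verts H" "a \<in> {1..?k}" for x a
      using s_eq[OF that(1) va(1)[OF that(2)]] va(2)[OF that(2)] by simp
    have "{(u, v, j) \<in> M. v = ith S a \<and> u = ith S b}
        = ?g ` {e \<in> arcs H. tail H e = vertex_at H \<pi> a \<and> head H e = vertex_at H \<pi> b}"
      (is "?L = ?g ` ?A")
    proof (intro equalityI subsetI)
      fix p assume "p \<in> ?L"
      then obtain e where e: "e \<in> arcs H" "p = ?g e" "?s (tail H e) = ith S a" "?s (head H e) = ith S b"
        by (auto simp: M_def)
      then have "e \<in> ?A" using conv ab by simp
      then show "p \<in> ?g ` ?A" using e(2) by blast
    next
      fix p assume "p \<in> ?g ` ?A"
      then obtain e where e: "e \<in> ?A" "p = ?g e" by blast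
      then have "p \<in> M" unfolding M_def by blast
      then show "p \<in> ?L" using e va ab by simp
    qed
    then have "card {(u, v, j) \<in> M. v = ith S a \<and> u = ith S b} =
       card (?g ` {e \<in> arcs H. tail H e = vertex_at H \<pi> a \<and> head H e = vertex_at H \<pi> b})" by simp
    also have "\<dots> = arc_count H \<pi> a b" unfolding arc_count_def
      by (rule card_image) (auto intro!: inj_onI intro: tail_lab)
    finally show "card {(u, v, j) \<in> M. v = ith S a \<and> u = ith S b} = arc_count H \<pi> a b" .
  qed
  moreover have "PA_edges m \<delta> M"
  proof
    show "1 \<le> m" "- real m < \<delta>" using \<delta> by auto
    show "finite M" by (simp add: M_def)
    show "1 \<le> u \<and> u < v \<and> l \<in> {1..m}" if "(u, v, l) \<in> M" for u v l
      using that edge by (auto simp: M_def)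
    show "u = u'" if "(u, v, l) \<in> M" "(u', v, l) \<in> M" for u u' v l
    proof -
      obtain e e' where e: "e \<in> arcs H" "(u, v, l) = ?g e" and e': "e' \<in> arcs H" "(u', v, l) = ?g e'"
        using \<open>(u, v, l) \<in> M\<close> \<open>(u', v, l) \<in> M\<close> unfolding M_def by (elim imageE)
      then have "e = e'" by (intro tail_lab) simp_all
      then show ?thesis using e e' by simp
    qed
  qed
  ultimately show ?thesis by blast
qed

lemma sum_arc_count:
  fixes H :: "('a, 'b) pre_digraph"
  assumes H: "fin_digraph H" "arrival_order H \<pi>" and a: "a \<in> {1..card (verts H)}"
  shows "(\<Sum>b=1..card (verts H). arc_count H \<pi> a b) = out_degree H (vertex_at H \<pi> a)"
    and "(\<Sum>b=1..card (verts H). arc_count H \<pi> b a) = in_degree H (vertex_at H \<pi> a)"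
proof -
  interpret fin_digraph H by (rule H(1))
  let ?k = "card (verts H)"
  have bij: "bij_betw (vertex_at H \<pi>) {1..?k} (verts H)"
    using bij_betw_inv_into[of \<pi> "verts H" "{1..?k}"] H(2)
    by (simp add: arrival_order_def vertex_at_def[abs_def])
  have "(\<Sum>b=1..?k. arc_count H \<pi> a b) =
      (\<Sum>y\<in>verts H. card {e \<in> out_arcs H (vertex_at H \<pi> a). head H e = y})"
    unfolding arc_count_def
    by (subst sum.reindex_bij_betw[OF bij, symmetric]) (auto intro!: sum.cong arg_cong[where f = card])
  also have "\<dots> = card (\<Union>y\<in>verts H. {e \<in> out_arcs H (vertex_at H \<pi> a). head H e = y})"
    by (rule card_UN_disjoint[symmetric]) auto
  also have "(\<Union>y\<in>verts H. {e \<in> out_arcs H (vertex_at H \<pi> a). head H e = y}) = out_arcs H (vertex_at H \<pi> a)"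
    by auto
  finally show "(\<Sum>b=1..?k. arc_count H \<pi> a b) = out_degree H (vertex_at H \<pi> a)"
    by (simp add: out_degree_def)
  have "(\<Sum>b=1..?k. arc_count H \<pi> b a) =
      (\<Sum>y\<in>verts H. card {e \<in> in_arcs H (vertex_at H \<pi> a). tail H e = y})"
    unfolding arc_count_def
    by (subst sum.reindex_bij_betw[OF bij, symmetric]) (auto intro!: sum.cong arg_cong[where f = card])
  also have "\<dots> = card (\<Union>y\<in>verts H. {e \<in> in_arcs H (vertex_at H \<pi> a). tail H e = y})"
    by (rule card_UN_disjoint[symmetric]) auto
  also have "(\<Union>y\<in>verts H. {e \<in> in_arcs H (vertex_at H \<pi> a). tail H e = y}) = in_arcs H (vertex_at H \<pi> a)"
    by auto
  finally show "(\<Sum>b=1..?k. arc_count H \<pi> b a) = in_degree H (vertex_at H \<pi> a)"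
    by (simp add: in_degree_def)
qed

text \<open>For each \<open>S\<close>, a single functional realisation gives the lower bound, while
  boundedly many realisations of equal weight give the upper one.\<close>

lemma expected_N_bounds:
  fixes H :: "('a, 'b) pre_digraph"
  assumes H: "fin_digraph H" "arrival_order H \<pi>" "attainable m H \<pi>"
    and m: "1 \<le> m" "\<delta> > - real m" and \<tau>: "\<tau> = 3 + \<delta> / real m"
  defines "b \<equiv> (\<lambda>a. beta_weight \<tau> H (vertex_at H \<pi> a))"
  shows "\<exists>c C. 0 < c \<and> 0 < C \<and> (\<forall>t\<ge>2.
     c * ordered_sum b (card (verts H)) t \<le> expected_N m \<delta> t H \<pi> \<and>
     expected_N m \<delta> t H \<pi> \<le> C * ordered_sum b (card (verts H)) t)"
proof -
  let ?k = "card (verts H)"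
  let ?c = "arc_count H \<pi>"
  let ?W = "\<lambda>S. \<Prod>a=1..?k. real (ith S a) powr b a"
  define N where "N = (\<Sum>a=1..?k. \<Sum>b=1..?k. ?c a b)"
  let ?p = "\<lambda>t M. measure_pmf.prob (PA m \<delta> t) {E. M \<subseteq> labeled_edges m t E}"
  obtain c C where cC: "0 < c" "0 < C" and bounds: "\<And>M t. PA_edges m \<delta> M \<Longrightarrow> card M = N \<Longrightarrow> 2 \<le> t \<Longrightarrow>
     (\<forall>(u, v, l)\<in>M. v \<le> t) \<Longrightarrow>
     c * PA_edges.edge_weight m \<delta> M \<le> ?p t M \<and> ?p t M \<le> C * PA_edges.edge_weight m \<delta> M"
    using edge_probability_bounds[OF m, of N] by blast
  have m0: "real m > 0" "2 * real m + \<delta> > 0" using m by linarith+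
  \<comment> \<open>With \<open>\<theta> = m / (2 m + \<delta>) = 1 / (\<tau> - 1)\<close>, the
    coefficient in \<open>beta_weight\<close> is \<open>1 - \<theta>\<close>, so the weight is
    \<open>- \<theta>\<close> times the in-degree plus \<open>\<theta> - 1\<close> times the
    out-degree.\<close>
  have \<tau>': "(\<tau> - 2) / (\<tau> - 1) = 1 - real m / (2 * real m + \<delta>)"
  proof -
    have "\<tau> - 2 = (real m + \<delta>) / real m" "\<tau> - 1 = (2 * real m + \<delta>) / real m" using m0 \<tau> by (auto simp: field_simps)
    then have "(\<tau> - 2) / (\<tau> - 1) = (real m + \<delta>) / (2 * real m + \<delta>)" using m0 by simp
    then show ?thesis using m0 by (simp add: field_simps)
  qed
  have b_eq: "b a = - (real m / (2 * real m + \<delta>)) * real (\<Sum>b=1..?k. ?c b a) + (real m / (2 * real m + \<delta>) - 1) * real (\<Sum>b=1..?k. ?c a b)"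
    if "a \<in> {1..?k}" for a
    unfolding sum_arc_count[OF H(1,2) that] b_def beta_weight_def \<tau>' by (simp add: algebra_simps)
  have W_nonneg: "?W S \<ge> 0" for S by (intro prod_nonneg) auto
  have "c * ?W S \<le> (\<Sum>M\<in>realizations m t ?k ?c S. ?p t M) \<and>
      (\<Sum>M\<in>realizations m t ?k ?c S. ?p t M) \<le> C * 2 ^ (?k * ?k * m) * ?W S"
    if t: "t \<ge> 2" and S: "S \<subseteq> {1..t}" "card S = ?k" for t S
  proof -
    have finS: "finite S" using S(1) finite_subset by blast
    have S0: "0 \<notin> S" using S by auto
    have both: "c * ?W S \<le> ?p t M \<and> ?p t M \<le> C * ?W S"
      if M: "M \<in> realizations m t ?k ?c S" and PA: "PA_edges m \<delta> M" for M
    proof -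
      have "PA_edges.edge_weight m \<delta> M = ?W S"
        unfolding realization_weight[OF finS S(2) S0 M PA] by (intro prod.cong refl) (simp only: b_eq)
      moreover have "card M = N" using realization_card[OF finS S(2) M] by (simp add: N_def)
      moreover have "\<forall>(u, v, l)\<in>M. v \<le> t" using M by (auto simp: realizations_def possible_edges_def)
      ultimately show ?thesis using bounds[OF PA _ t] by auto
    qed
    have upper: "?p t M \<le> C * ?W S" if M: "M \<in> realizations m t ?k ?c S" for M
    proof (cases "PA_edges m \<delta> M")
      case True
      then show ?thesis using both[OF M] by simp
    next
      case False
      \<comment> \<open>Any edge set contained in a realisation satisfies the locale assumptions
        because targets are a function of vertex and label; the remaining sets thus have probability
        0.\<close>
      have "{E. M \<subseteq> labeled_edges m t E} = {}"
      proof (rule ccontr)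
        assume "{E. M \<subseteq> labeled_edges m t E} \<noteq> {}"
        then obtain E where E: "M \<subseteq> labeled_edges m t E" by blast
        have "PA_edges m \<delta> M"
        proof
          show "1 \<le> m" "- real m < \<delta>" using m by auto
          show "finite M" using M finite_possible_edges finite_subset by (auto simp: realizations_def)
        qed (use E in \<open>auto simp: labeled_edges_def\<close>)
        then show False using False by simp
      qed
      then show ?thesis using W_nonneg cC by simp
    qed
    have "(\<Sum>M\<in>realizations m t ?k ?c S. ?p t M) \<le> real (card (realizations m t ?k ?c S)) * (C * ?W S)"
      by (rule sum_bounded_above) (rule upper)
    also have "\<dots> \<le> 2 ^ (?k * ?k * m) * (C * ?W S)"
    proof (intro mult_right_mono mult_nonneg_nonneg W_nonneg)
      have "real (card (realizations m t ?k ?c S)) \<le> real (2 ^ (?k * ?k * m))"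
        using card_realizations_le[OF finS S(2)] of_nat_mono by blast
      then show "real (card (realizations m t ?k ?c S)) \<le> 2 ^ (?k * ?k * m)" by simp
    qed (use cC in auto)
    finally have 1: "(\<Sum>M\<in>realizations m t ?k ?c S. ?p t M) \<le> C * 2 ^ (?k * ?k * m) * ?W S"
      by (simp add: ac_simps)
    obtain M where M: "M \<in> realizations m t ?k ?c S" "PA_edges m \<delta> M"
      using realization_exists[OF H S m] by blast
    have "c * ?W S \<le> ?p t M" using both[OF M] by simp
    also have "\<dots> \<le> (\<Sum>M\<in>realizations m t ?k ?c S. ?p t M)"
      by (rule member_le_sum[OF M(1)]) (auto simp: finite_realizations)
    finally show ?thesis using 1 by simp
  qed
  note per_S = this
  have os: "ordered_sum b ?k t = (\<Sum>S | S \<subseteq> {1..t} \<and> card S = ?k. ?W S)" for t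
    by (simp add: ordered_sum_eq ith_def)
  have "c * ordered_sum b ?k t \<le> expected_N m \<delta> t H \<pi>"
    "expected_N m \<delta> t H \<pi> \<le> C * 2 ^ (?k * ?k * m) * ordered_sum b ?k t" if "t \<ge> 2" for t
    unfolding os expected_N_eq sum_distrib_left using per_S[OF that] by (auto intro!: sum_mono)
  then show ?thesis using cC by (intro exI[of _ c] exI[of _ "C * 2 ^ (?k * ?k * m)"]) auto
qed

section \<open>Translation to the stated exponent and the limit\<close>

lemma objective_eq_tail_weight:
  assumes "s \<le> card (verts H)"
  shows "real (card (verts H)) + B_objective \<tau> H \<pi> s
    = tail_weight (\<lambda>a. beta_weight \<tau> H (vertex_at H \<pi> a)) (card (verts H)) s"
  using assms by (simp add: B_objective_def tail_weight_def sum.distrib of_nat_diff)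

lemma exponent_eq_max_tail:
  "real (card (verts H)) + B_exponent \<tau> H \<pi>
    = max_tail (\<lambda>a. beta_weight \<tau> H (vertex_at H \<pi> a)) (card (verts H))"
proof -
  let ?k = "card (verts H)"
  have "real ?k + B_exponent \<tau> H \<pi> = Max ((\<lambda>x. real ?k + x) ` (B_objective \<tau> H \<pi> ` {0..?k}))"
    unfolding B_exponent_def by (rule mono_Max_commute) (auto simp: mono_def)
  also have "(\<lambda>x. real ?k + x) ` (B_objective \<tau> H \<pi> ` {0..?k}) =
      tail_weight (\<lambda>a. beta_weight \<tau> H (vertex_at H \<pi> a)) ?k ` {0..?k}"
    unfolding image_image by (intro image_cong refl objective_eq_tail_weight) auto
  finally show ?thesis by (simp add: max_tail_def)
qed

lemma num_maximizers_eq: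
  "num_maximizers \<tau> H \<pi> = num_max_tail (\<lambda>a. beta_weight \<tau> H (vertex_at H \<pi> a)) (card (verts H))"
proof -
  have "B_objective \<tau> H \<pi> s = B_exponent \<tau> H \<pi> \<longleftrightarrow>
     tail_weight (\<lambda>a. beta_weight \<tau> H (vertex_at H \<pi> a)) (card (verts H)) s
      = max_tail (\<lambda>a. beta_weight \<tau> H (vertex_at H \<pi> a)) (card (verts H))"
    if "s \<le> card (verts H)" for s
    using objective_eq_tail_weight[OF that, of \<tau> \<pi>] exponent_eq_max_tail[of H \<tau> \<pi>] by linarith
  then show ?thesis unfolding num_maximizers_def num_max_tail_def
    by (intro arg_cong[where f = card]) auto
qed

text \<open>Removes both shifts, of the argument and of the logarithm. From
  \<open>t >= 3 >= exp 1\<close> it follows that \<open>ln t >= 1\<close>, hence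
  \<open>1 + ln t <= 2 * ln t\<close>.\<close>

lemma powlog_Suc_bounds:
  assumes t: "t \<ge> (3::nat)"
  shows "powlog g q (real (Suc t)) \<le> 2 powr \<bar>g\<bar> * 2 ^ q * 2 ^ q * (real t powr g * ln (real t) ^ q)"
    and "real t powr g * ln (real t) ^ q \<le> 2 powr \<bar>g\<bar> * 2 ^ q * powlog g q (real (Suc t))"
proof -
  have "exp 1 \<le> real t" using exp_le t by linarith
  then have ln1: "1 \<le> ln (real t)" using t by (simp add: ln_ge_iff)
  have cmp: "powlog g q (real (Suc t)) \<le> (2 powr \<bar>g\<bar> * 2 ^ q) * powlog g q (real t)"
    "powlog g q (real t) \<le> (2 powr \<bar>g\<bar> * 2 ^ q) * powlog g q (real (Suc t))"
    using powlog_compare[of "real t" "real (Suc t)"] t by auto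
  have "(1 + ln (real t)) ^ q \<le> (2 * ln (real t)) ^ q" using ln1 by (intro power_mono) auto
  then have "powlog g q (real t) \<le> real t powr g * (2 ^ q * ln (real t) ^ q)"
    unfolding powlog_def power_mult_distrib by (intro mult_left_mono) auto
  then have "(2 powr \<bar>g\<bar> * 2 ^ q) * powlog g q (real t) \<le> (2 powr \<bar>g\<bar> * 2 ^ q) * (real t powr g * (2 ^ q * ln (real t) ^ q))"
    by (intro mult_left_mono) auto
  with cmp(1) show "powlog g q (real (Suc t)) \<le> 2 powr \<bar>g\<bar> * 2 ^ q * 2 ^ q * (real t powr g * ln (real t) ^ q)"
    by (simp only: ac_simps)
  have "real t powr g * ln (real t) ^ q \<le> powlog g q (real t)"
    unfolding powlog_def using ln1 by (intro mult_left_mono power_mono) auto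
  with cmp(2) show "real t powr g * ln (real t) ^ q \<le> 2 powr \<bar>g\<bar> * 2 ^ q * powlog g q (real (Suc t))" by simp
qed

theorem theorem2p2:
  fixes m k r :: nat and \<delta> \<tau> :: real
    and H :: "('a, 'b) pre_digraph" and \<pi> :: "'a \<Rightarrow> nat"
  assumes "m \<ge> 2" and "\<delta> > - real m" and "\<tau> = 3 + \<delta> / real m"
    and "fin_digraph H" and "Digraph_Component.connected H" and "card (verts H) = k"
    and "arrival_order H \<pi>" and "attainable m H \<pi>"
    and "r = num_maximizers \<tau> H \<pi>"
  shows "let R = (\<lambda>t. ereal (expected_N m \<delta> t H \<pi>
                 / (real t powr (real k + B_exponent \<tau> H \<pi>) * ln (real t) ^ (r - 1))))
         in \<exists>C1 C2 :: real. 0 < C1 \<and> C1 \<le> C2 \<and>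
              ereal C1 \<le> liminf R \<and> liminf R \<le> limsup R \<and> limsup R \<le> ereal C2"
proof -
  define b where "b = (\<lambda>a. beta_weight \<tau> H (vertex_at H \<pi> a))"
  define g where "g = real k + B_exponent \<tau> H \<pi>"
  define q where "q = r - 1"
  define D where "D = (\<lambda>t::nat. real t powr g * ln (real t) ^ q)"
  define R where "R = (\<lambda>t. ereal (expected_N m \<delta> t H \<pi> / D t))"
  have g: "max_tail b k = g" and q: "num_max_tail b k - 1 = q"
    using exponent_eq_max_tail[of H \<tau> \<pi>] num_maximizers_eq[of \<tau> H \<pi>] assms(6,9)
    by (simp_all add: b_def g_def q_def)
  obtain c C where cC: "0 < c" "0 < C"
    "\<And>t. t \<ge> 2 \<Longrightarrow> c * ordered_sum b k t \<le> expected_N m \<delta> t H \<pi>"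
    "\<And>t. t \<ge> 2 \<Longrightarrow> expected_N m \<delta> t H \<pi> \<le> C * ordered_sum b k t"
    using expected_N_bounds[OF assms(4,7,8) _ assms(2,3)] assms(1,6) unfolding b_def by auto
  obtain c' C' where cC': "0 < c'" "0 < C'"
    "\<And>t. t \<ge> k \<Longrightarrow> c' * powlog g q (real (Suc t)) \<le> ordered_sum b k t"
    "\<And>t. ordered_sum b k t \<le> C' * powlog g q (real (Suc t))"
    using ordered_sum_bounds[of k b] unfolding g q by blast
  define K where "K = 2 powr \<bar>g\<bar> * 2 ^ q"
  have K: "K > 0" by (simp add: K_def)
  define C1 where "C1 = c * c' / K"
  define C2 where "C2 = C * C' * (K * 2 ^ q)"
  have C1: "C1 > 0" using cC cC' K by (simp add: C1_def)
  have D_pos: "D t > 0" if "t \<ge> 3" for t using that by (simp add: D_def)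
  \<comment> \<open>The threshold 3 makes the logarithm at least 1, and \<open>k\<close> makes room
    for \<open>k\<close> increasing indices.\<close>
  have lower: "C1 \<le> expected_N m \<delta> t H \<pi> / D t" if t: "t \<ge> max 3 k" for t
  proof -
    have "D t \<le> K * powlog g q (real (Suc t))"
      using powlog_Suc_bounds(2)[of t g q] t by (simp add: D_def K_def)
    then have "c * c' / K * D t \<le> c * c' / K * (K * powlog g q (real (Suc t)))"
      using cC cC' K by (intro mult_left_mono) auto
    also have "\<dots> = c * (c' * powlog g q (real (Suc t)))" using K by simp
    also have "\<dots> \<le> c * ordered_sum b k t" using cC(1) cC'(3)[of t] t by (intro mult_left_mono) auto
    also have "\<dots> \<le> expected_N m \<delta> t H \<pi>" using cC(3) t by simp
    finally show ?thesis using D_pos[of t] t by (simp add: C1_def pos_le_divide_eq)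
  qed
  have upper: "expected_N m \<delta> t H \<pi> / D t \<le> C2" if t: "t \<ge> max 3 k" for t
  proof -
    have "expected_N m \<delta> t H \<pi> \<le> C * ordered_sum b k t" using cC(4) t by simp
    also have "\<dots> \<le> C * (C' * powlog g q (real (Suc t)))" using cC(2) cC'(4) by (intro mult_left_mono) auto
    also have "\<dots> \<le> C * (C' * (K * 2 ^ q * D t))"
      using powlog_Suc_bounds(1)[of t g q] t cC cC' by (intro mult_left_mono) (auto simp: D_def K_def)
    finally show ?thesis using D_pos[of t] t by (simp add: C2_def pos_divide_le_eq ac_simps)
  qed
  \<comment> \<open>Both constants bound the same quotient at one admissible time.\<close>
  have "C1 \<le> C2" using lower[of "max 3 k"] upper[of "max 3 k"] by linarith
  moreover have "ereal C1 \<le> liminf R"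
    by (intro Liminf_bounded eventually_sequentiallyI[of "max 3 k"]) (auto simp: R_def intro!: lower)
  moreover have "limsup R \<le> ereal C2"
    by (intro Limsup_bounded eventually_sequentiallyI[of "max 3 k"]) (auto simp: R_def intro!: upper)
  moreover have "liminf R \<le> limsup R" by (rule Liminf_le_Limsup) simp
  ultimately show ?thesis
    using C1 unfolding Let_def R_def D_def g_def q_def by blast
qed

end
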